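(* The class of representable matroids is properly contained in $\mathcal{K}_\infty$; that is, every representable matroid is in $\mathcal{K}_\infty$, and there is a matroid in $\mathcal{K}_\infty$ that is not representable.
   Context: All matroids are finite. A matroid is representable if it is representable over some field, i.e. its elements can be identified with (a family of) vectors in a vector space over some field so that matroid rank is linear rank. For a matroid $M$ with rank function $r$ and ground set $E(M)$, and an integer $n\geq 4$, the $n$-th Kinser inequality for a family $X_1,\dots,X_n$ of subsets of $E(M)$ is $$\sum_{i=3}^n r(X_i)+r(X_1\cup X_2)+r(X_1\cup X_3\cup X_n)+\sum_{i=4}^n r(X_2\cup X_{i-1}\cup X_i)\leq r(X_1\cup X_3)+r(X_1\cup X_n)+\sum_{i=3}^n r(X_2\cup X_i)+\sum_{i=4}^n r(X_{i-1}\cup X_i).$$ $\mathcal{K}_n$ is the class of matroids $M$ that satisfy the $n$-th Kinser inequality for all families $X_1,\dots,X_n$ of subsets of $E(M)$, and $\mathcal{K}_\infty=\bigcap_{i\geq 4}\mathcal{K}_i$. *)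

theory Defs
  imports "Jordan_Normal_Form.Missing_VectorSpace" "HOL-Algebra.Weak_Morphisms" "HOL-Algebra.Generated_Fields" "HOL-Library.Countable_Set"
begin

locale matroid =
  fixes E :: "'a set" and indep :: "'a set \<Rightarrow> bool"
  assumes finite_ground: "finite E"
    and indep_subset_ground: "indep I \<Longrightarrow> I \<subseteq> E"
    and indep_empty: "indep {}"
    and indep_subset: "indep I \<Longrightarrow> J \<subseteq> I \<Longrightarrow> indep J"
    and indep_augment: "indep I \<Longrightarrow> indep J \<Longrightarrow> card I < card J \<Longrightarrow>
      \<exists>x \<in> J - I. indep (insert x I)"

definition matroid_rank :: "('a set \<Rightarrow> bool) \<Rightarrow> 'a set \<Rightarrow> nat" where
  "matroid_rank indep X = Max (card ` {I. I \<subseteq> X \<and> indep I})"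

type_synonym 'a matroid = "'a set \<times> ('a set \<Rightarrow> bool)"

definition kinser_inequality :: "nat \<Rightarrow> ('a set \<Rightarrow> nat) \<Rightarrow> (nat \<Rightarrow> 'a set) \<Rightarrow> bool" where
  "kinser_inequality n r X \<longleftrightarrow>
     (\<Sum>i=3..n. r (X i)) + r (X 1 \<union> X 2) + r (X 1 \<union> X 3 \<union> X n)
       + (\<Sum>i=4..n. r (X 2 \<union> X (i - 1) \<union> X i))
     \<le> r (X 1 \<union> X 3) + r (X 1 \<union> X n) + (\<Sum>i=3..n. r (X 2 \<union> X i))
       + (\<Sum>i=4..n. r (X (i - 1) \<union> X i))"

definition kinser_class :: "nat \<Rightarrow> 'a matroid set" where
  "kinser_class n = {(E, indep). matroid E indep \<and>
     (\<forall>X. (\<forall>i\<in>{1..n}. X i \<subseteq> E) \<longrightarrow> kinser_inequality n (matroid_rank indep) X)}"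

definition kinser_class_infinity :: "'a matroid set" where
  "kinser_class_infinity = (\<Inter>n\<in>{4..}. kinser_class n)"

text \<open>The map \<open>\<phi>\<close> need not be injective (parallel elements) and may hit zero (loops).\<close>

definition represents ::
  "('k, 'm) ring_scheme \<Rightarrow> ('k, 'v, 'n) module_scheme \<Rightarrow> ('a \<Rightarrow> 'v) \<Rightarrow> 'a matroid \<Rightarrow> bool" where
  "represents K V \<phi> M \<longleftrightarrow> (case M of (E, indep) \<Rightarrow>
     vectorspace K V \<and> \<phi> \<in> E \<rightarrow> carrier V \<and>
     (\<forall>X \<subseteq> E. matroid_rank indep X =
        vectorspace.dim K (V\<lparr>carrier := LinearCombinations.module.span K V (\<phi> ` X)\<rparr>)))"

text \<open>A formula cannot quantify over the type carrying a field. Fields and vector spaces whose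
  carriers are sets of natural numbers suffice, because finitely many vectors only involve
  countably many scalars; theorem \<open>represents_imp_representable\<close> below shows that a
  matroid represented over any field, of any type and cardinality, is representable in this
  sense.\<close>

definition representable_matroids :: "'a matroid set" where
  "representable_matroids = {(E, indep). matroid E indep \<and>
     (\<exists>(K :: nat ring) (V :: (nat, nat) module) \<phi>. represents K V \<phi> (E, indep))}"

lemma (in vectorspace) ex_indep_spanning_subset:
  assumes "finite S" "S \<subseteq> carrier V"
  shows "\<exists>B \<subseteq> S. lin_indpt B \<and> S \<subseteq> span B"
  using assms
proof (induction S rule: finite_induct)
  case empty
  have "lin_indpt {}" unfolding lin_dep_def by auto
  then show ?case by blast
next
  case (insert x S)
  then obtain B where B: "B \<subseteq> S" "lin_indpt B" "S \<subseteq> span B" by auto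
  have BV: "B \<subseteq> carrier V" and x: "x \<in> carrier V" using B insert.prems by auto
  show ?case
  proof (cases "x \<in> span B")
    case True
    then show ?thesis using B by blast
  next
    case False
    then have "x \<notin> B" using in_own_span[OF BV] by auto
    then have "lin_indpt (B \<union> {x})"
      using lin_dep_iff_in_span[OF BV B(2) x] False by auto
    moreover have "insert x S \<subseteq> span (B \<union> {x})"
      using B(3) span_is_monotone[of B "B \<union> {x}"] in_own_span[of "B \<union> {x}"] BV x by auto
    ultimately show ?thesis using B(1) by (intro exI[of _ "B \<union> {x}"]) auto
  qed
qed

lemma (in vectorspace) dim_span_eq_card:
  assumes "finite S" "S \<subseteq> carrier V" "B \<subseteq> S" "lin_indpt B" "S \<subseteq> span B"
  shows "vectorspace.dim K (vs (span S)) = card B"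
proof -
  have BV: "B \<subseteq> carrier V" using assms by auto
  have eq: "span S = span B"
  proof
    show "span B \<subseteq> span S" using span_is_monotone assms(3) by auto
    show "span S \<subseteq> span B" using span_is_subset[OF assms(5) span_is_submodule[OF BV]] .
  qed
  have sub: "VectorSpace.subspace K (span B) V" using span_is_subspace[OF BV] .
  interpret W: vectorspace K "vs (span B)" using subspace_is_vs[OF sub] .
  have BW: "B \<subseteq> span B" using in_own_span[OF BV] .
  note li = span_li_not_depend[OF BW span_is_submodule[OF BV]]
  have "W.basis B" unfolding W.basis_def using li assms(4) BW by auto
  then have "W.dim = card B" using W.dim_basis finite_subset[OF assms(3,1)] by auto
  then show ?thesis by (simp add: eq)
qed

lemma countable_generate_field:
  assumes "countable C"
  shows "countable (generate_field R C)"
proof -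
  define st where "st A = A \<union> (\<lambda>x. \<ominus>\<^bsub>R\<^esub> x) ` A \<union> (\<lambda>x. inv\<^bsub>R\<^esub> x) ` A
    \<union> (\<lambda>(x, y). x \<oplus>\<^bsub>R\<^esub> y) ` (A \<times> A) \<union> (\<lambda>(x, y). x \<otimes>\<^bsub>R\<^esub> y) ` (A \<times> A)" for A
  define G where "G n = (st ^^ n) (insert \<one>\<^bsub>R\<^esub> C)" for n
  have cG: "countable (G n)" for n
    by (induction n) (auto simp: G_def st_def assms)
  have step: "G (Suc n) = st (G n)" for n by (simp add: G_def)
  have mono: "G m \<subseteq> G n" if "m \<le> n" for m n
    using that by (induction rule: dec_induct) (auto simp: step st_def)
  have two: "\<exists>n. x \<in> G n \<and> y \<in> G n" if "x \<in> G i" "y \<in> G j" for x y i j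
    using that mono[of i "max i j"] mono[of j "max i j"] by (intro exI[of _ "max i j"]) auto
  have "x \<in> (\<Union>n. G n)" if "x \<in> generate_field R C" for x
    using that
  proof induction
    case one
    have "\<one>\<^bsub>R\<^esub> \<in> G 0" by (simp add: G_def)
    then show ?case by blast
  next
    case (incl h)
    then have "h \<in> G 0" by (simp add: G_def)
    then show ?case by blast
  next
    case (a_inv h)
    then obtain n where "h \<in> G n" by auto
    then have "\<ominus>\<^bsub>R\<^esub> h \<in> G (Suc n)" by (auto simp: step st_def)
    then show ?case by blast
  next
    case (m_inv h)
    then obtain n where "h \<in> G n" by auto
    then have "inv\<^bsub>R\<^esub> h \<in> G (Suc n)" by (auto simp: step st_def)
    then show ?case by blast
  next
    case (eng_add h1 h2)
    then obtain n where "h1 \<in> G n" "h2 \<in> G n" using two by blast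
    then have "h1 \<oplus>\<^bsub>R\<^esub> h2 \<in> G (Suc n)" by (auto simp: step st_def)
    then show ?case by blast
  next
    case (eng_mult h1 h2)
    then obtain n where "h1 \<in> G n" "h2 \<in> G n" using two by blast
    then have "h1 \<otimes>\<^bsub>R\<^esub> h2 \<in> G (Suc n)" by (auto simp: step st_def)
    then show ?case by blast
  qed
  then show ?thesis
    using cG by (meson countable_UN countable_subset subsetI countableI_type)
qed

lemma countable_PiE_const:
  assumes "finite A" "countable F"
  shows "countable (A \<rightarrow>\<^sub>E F)"
  using assms by (induction rule: finite_induct) (auto simp: PiE_insert_eq)

lemma lincomb_transfer:
  assumes "vectorspace K V" "vectorspace K' V'"
    and "F \<subseteq> carrier K" "W \<subseteq> carrier V" "f \<in> F \<rightarrow> carrier K'" "g \<in> W \<rightarrow> carrier V'"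
    and "inj_on g W" "\<zero>\<^bsub>V\<^esub> \<in> W" "g \<zero>\<^bsub>V\<^esub> = \<zero>\<^bsub>V'\<^esub>"
    and add: "\<And>v w. v \<in> W \<Longrightarrow> w \<in> W \<Longrightarrow> v \<oplus>\<^bsub>V\<^esub> w \<in> W \<and> g (v \<oplus>\<^bsub>V\<^esub> w) = g v \<oplus>\<^bsub>V'\<^esub> g w"
    and smult: "\<And>a v. a \<in> F \<Longrightarrow> v \<in> W \<Longrightarrow> a \<odot>\<^bsub>V\<^esub> v \<in> W \<and> g (a \<odot>\<^bsub>V\<^esub> v) = f a \<odot>\<^bsub>V'\<^esub> g v"
    and "finite B" "B \<subseteq> W" "c \<in> B \<rightarrow> F"
    and c': "\<And>v. v \<in> B \<Longrightarrow> c' (g v) = f (c v)"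
  shows "LinearCombinations.module.lincomb V c B \<in> W \<and>
    LinearCombinations.module.lincomb V' c' (g ` B) = g (LinearCombinations.module.lincomb V c B)"
proof -
  interpret V: vectorspace K V by fact
  interpret V': vectorspace K' V' by fact
  show ?thesis
    using \<open>finite B\<close> \<open>B \<subseteq> W\<close> \<open>c \<in> B \<rightarrow> F\<close> c'
  proof (induction B rule: finite_induct)
    case empty
    then show ?case using assms by (simp add: V.lincomb_def V'.lincomb_def)
  next
    case (insert x B)
    have IH: "V.lincomb c B \<in> W" "V'.lincomb c' (g ` B) = g (V.lincomb c B)"
      using insert by auto
    have x: "x \<in> W" "c x \<in> F" using insert.prems by auto
    have gx: "g x \<notin> g ` B"
      using insert.hyps insert.prems \<open>inj_on g W\<close> by (auto simp: inj_on_def)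
    have 1: "V.lincomb c (insert x B) = (c x \<odot>\<^bsub>V\<^esub> x) \<oplus>\<^bsub>V\<^esub> V.lincomb c B"
    proof (rule V.lincomb_insert2)
      show "c \<in> insert x B \<rightarrow> carrier K" using insert.prems assms(3) by fastforce
    qed (use insert.hyps insert.prems assms(4) in auto)
    have 2: "V'.lincomb c' (insert (g x) (g ` B))
        = (c' (g x) \<odot>\<^bsub>V'\<^esub> g x) \<oplus>\<^bsub>V'\<^esub> V'.lincomb c' (g ` B)"
    proof (rule V'.lincomb_insert2)
      show "c' \<in> insert (g x) (g ` B) \<rightarrow> carrier K'"
        using insert.prems assms(5) by fastforce
      show "g ` B \<subseteq> carrier V'" "g x \<in> carrier V'" using insert.prems assms(6) by auto
    qed (use insert.hyps gx in auto)
    show ?case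
      using x IH add smult 1 2 insert.prems by simp
  qed
qed

lemma dim_span_transfer:
  assumes "vectorspace K V" "vectorspace K' V'"
    and "F \<subseteq> carrier K" "W \<subseteq> carrier V" "f ` F = carrier K'" "g ` W = carrier V'"
    and "inj_on f F" "\<zero>\<^bsub>K\<^esub> \<in> F" "f \<zero>\<^bsub>K\<^esub> = \<zero>\<^bsub>K'\<^esub>"
    and "inj_on g W" "\<zero>\<^bsub>V\<^esub> \<in> W" "g \<zero>\<^bsub>V\<^esub> = \<zero>\<^bsub>V'\<^esub>"
    and add: "\<And>v w. v \<in> W \<Longrightarrow> w \<in> W \<Longrightarrow> v \<oplus>\<^bsub>V\<^esub> w \<in> W \<and> g (v \<oplus>\<^bsub>V\<^esub> w) = g v \<oplus>\<^bsub>V'\<^esub> g w"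
    and smult: "\<And>a v. a \<in> F \<Longrightarrow> v \<in> W \<Longrightarrow> a \<odot>\<^bsub>V\<^esub> v \<in> W \<and> g (a \<odot>\<^bsub>V\<^esub> v) = f a \<odot>\<^bsub>V'\<^esub> g v"
    and S: "finite S" "S \<subseteq> W" "B \<subseteq> S"
    and li: "\<not> LinearCombinations.module.lin_dep K V B"
    and sp: "\<And>s. s \<in> S \<Longrightarrow> \<exists>c \<in> B \<rightarrow> F. s = LinearCombinations.module.lincomb V c B"
  shows "vectorspace.dim K' (V'\<lparr>carrier := LinearCombinations.module.span K' V' (g ` S)\<rparr>) = card B"
proof -
  interpret V: vectorspace K V by fact
  interpret V': vectorspace K' V' by fact
  have fF: "f \<in> F \<rightarrow> carrier K'" and gW: "g \<in> W \<rightarrow> carrier V'" using assms(5,6) by auto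
  note tr = lincomb_transfer[OF assms(1,2,3,4) fF gW assms(10,11,12) add smult]
  have B: "finite B" "B \<subseteq> W" using S finite_subset by auto
  have injB: "inj_on g B" using B assms(10) inj_on_subset by blast
  have gB: "g ` B \<subseteq> carrier V'" "finite (g ` B)" using B gW by auto
  have li': "V'.lin_indpt (g ` B)"
  proof (rule V'.finite_lin_indpt2[OF gB(2,1)])
    fix a assume a: "a \<in> g ` B \<rightarrow> carrier K'" and z: "V'.lincomb a (g ` B) = \<zero>\<^bsub>V'\<^esub>"
    define c where "c v = inv_into F f (a (g v))" for v
    have aF: "a (g v) \<in> f ` F" if "v \<in> B" for v using a that assms(5) by auto
    have c: "c \<in> B \<rightarrow> F" using aF unfolding c_def by (auto intro: inv_into_into)
    have fc: "a (g v) = f (c v)" if "v \<in> B" for v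
      using aF[OF that] unfolding c_def by (simp add: f_inv_into_f)
    have t: "V.lincomb c B \<in> W" "V'.lincomb a (g ` B) = g (V.lincomb c B)"
      using tr[of B c a] B c fc by auto
    then have "V.lincomb c B = \<zero>\<^bsub>V\<^esub>"
      using z assms(10,11,12) by (metis inj_onD)
    then have "c \<in> B \<rightarrow> {\<zero>\<^bsub>K\<^esub>}"
      using V.not_lindepD[OF li B(1) subset_refl] c assms(3) by blast
    then show "\<forall>v\<in>g ` B. a v = \<zero>\<^bsub>K'\<^esub>" using fc assms(9) by (auto simp: Pi_iff)
  qed
  have "g ` S \<subseteq> V'.span (g ` B)"
  proof
    fix y assume "y \<in> g ` S"
    then obtain s where s: "s \<in> S" "y = g s" by auto
    then obtain c where c: "c \<in> B \<rightarrow> F" "s = V.lincomb c B" using sp by blast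
    define a where "a w = f (c (inv_into B g w))" for w
    have "V'.lincomb a (g ` B) = y"
      using tr[of B c a] B c s injB by (auto simp: a_def)
    moreover have "a \<in> g ` B \<rightarrow> carrier K'"
      using c fF injB by (auto simp: a_def)
    ultimately show "y \<in> V'.span (g ` B)"
      unfolding V'.span_def using gB(2) by blast
  qed
  then have "vectorspace.dim K' (V'.vs (V'.span (g ` S))) = card (g ` B)"
    using V'.dim_span_eq_card[of "g ` S" "g ` B"] li' S gW by blast
  then show ?thesis using card_image[OF injB] by simp
qed

lemma image_ring_field:
  assumes "field R" "inj_on f (carrier R)"
  shows "field (image_ring f R)"
    "a \<in> carrier R \<Longrightarrow> b \<in> carrier R \<Longrightarrow> f a \<otimes>\<^bsub>image_ring f R\<^esub> f b = f (a \<otimes>\<^bsub>R\<^esub> b)"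
    "a \<in> carrier R \<Longrightarrow> b \<in> carrier R \<Longrightarrow> f a \<oplus>\<^bsub>image_ring f R\<^esub> f b = f (a \<oplus>\<^bsub>R\<^esub> b)"
  using field.inj_imp_image_ring_is_field[OF assms] assms(2)
  by (auto simp: image_ring_def image_group_def monoid.defs)

theorem represents_imp_representable:
  assumes "matroid E indep" and rep: "represents K V \<phi> (E, indep)"
  shows "(E, indep) \<in> representable_matroids"
proof -
  have finE: "finite E" using assms(1) by (simp add: matroid.finite_ground)
  have VS: "vectorspace K V" and \<phi>: "\<phi> \<in> E \<rightarrow> carrier V"
    and rk: "\<And>X. X \<subseteq> E \<Longrightarrow>
      matroid_rank indep X = vectorspace.dim K (V\<lparr>carrier := LinearCombinations.module.span K V (\<phi> ` X)\<rparr>)"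
    using rep by (auto simp: represents_def)
  interpret V: vectorspace K V by fact
  have carr: "\<phi> ` X \<subseteq> carrier V" "finite (\<phi> ` X)" if "X \<subseteq> E" for X
    using \<phi> that finite_subset[OF that finE] by auto
  have ex: "\<exists>B. B \<subseteq> \<phi> ` X \<and> V.lin_indpt B \<and> \<phi> ` X \<subseteq> V.span B" if "X \<subseteq> E" for X
    using V.ex_indep_spanning_subset[OF carr(2,1)[OF that]] by blast
  obtain B where B: "\<And>X. X \<subseteq> E \<Longrightarrow>
      B X \<subseteq> \<phi> ` X \<and> V.lin_indpt (B X) \<and> \<phi> ` X \<subseteq> V.span (B X)"
    using ex by metis
  have "\<exists>c. c \<in> B X \<rightarrow> carrier K \<and> \<phi> x = V.lincomb c (B X)" if "X \<subseteq> E" "x \<in> X" for X x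
    using V.finite_in_span[of "B X" "\<phi> x"] B[OF that(1)] carr[OF that(1)] that(2)
    by (metis finite_subset image_subset_iff subset_trans)
  then obtain c where c: "\<And>X x. X \<subseteq> E \<Longrightarrow> x \<in> X \<Longrightarrow>
      c X x \<in> B X \<rightarrow> carrier K \<and> \<phi> x = V.lincomb (c X x) (B X)"
    by metis
  define C where "C = (\<Union>X\<in>Pow E. \<Union>x\<in>X. c X x ` B X)"
  have "finite (B X)" if "X \<subseteq> E" for X
    using B[OF that] carr[OF that] by (meson finite_subset)
  then have "finite (\<Union>x\<in>X. c X x ` B X)" if "X \<subseteq> E" for X
    using that finite_subset[OF that finE] by blast
  then have "finite C"
    unfolding C_def using finE by (intro finite_UN_I[of "Pow E"]) blast+
  then have "countable C" by (rule countable_finite)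
  have CK: "C \<subseteq> carrier K" unfolding C_def using c by blast
  define F where "F = generate_field K C"
  have cF: "countable F" unfolding F_def by (rule countable_generate_field) fact
  have FK: "F \<subseteq> carrier K" unfolding F_def by (rule V.generate_field_incl[OF CK])
  have F0: "\<zero>\<^bsub>K\<^esub> \<in> F" "\<one>\<^bsub>K\<^esub> \<in> F"
    unfolding F_def by (auto intro: V.zero_in_generate generate_field.one)
  have Fadd: "a \<oplus>\<^bsub>K\<^esub> b \<in> F" and Fmult: "a \<otimes>\<^bsub>K\<^esub> b \<in> F" if "a \<in> F" "b \<in> F" for a b
    using that unfolding F_def by (auto intro: generate_field.intros)
  have cC: "c X x \<in> B X \<rightarrow> F" if "X \<subseteq> E" "x \<in> X" for X x
    unfolding F_def C_def using that by (auto intro!: generate_field.incl)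
  let ?KF = "K\<lparr>carrier := F\<rparr>"
  have KF: "field ?KF" unfolding F_def by (rule V.generate_field_is_field[OF CK])
  have "vectorspace ?KF V"
    by (rule vs_criteria[OF KF])
       (use FK in \<open>auto simp: V.M.a_ac V.smult_l_distr V.smult_r_distr V.smult_assoc1 subset_iff
          intro: V.M.r_neg\<close>)
  then interpret VF: vectorspace ?KF V .
  define W where "W = VF.span (\<phi> ` E)"
  have \<phi>E: "\<phi> ` E \<subseteq> carrier V" "finite (\<phi> ` E)" using carr by auto
  have sub: "VectorSpace.subspace ?KF W V" unfolding W_def by (rule VF.span_is_subspace[OF \<phi>E(1)])
  interpret VW: vectorspace ?KF "V\<lparr>carrier := W\<rparr>" by (rule VF.subspace_is_vs[OF sub])
  have WV: "W \<subseteq> carrier V" unfolding W_def by (rule VF.span_is_subset2[OF \<phi>E(1)])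
  have \<phi>W: "\<phi> ` E \<subseteq> W" unfolding W_def by (rule VF.in_own_span[OF \<phi>E(1)])
  have "W \<subseteq> (\<lambda>a. VF.lincomb a (\<phi> ` E)) ` (\<phi> ` E \<rightarrow>\<^sub>E F)"
  proof
    fix w assume "w \<in> W"
    then obtain a where a: "a \<in> \<phi> ` E \<rightarrow> F" "w = VF.lincomb a (\<phi> ` E)"
      unfolding W_def VF.finite_span[OF \<phi>E(2,1)] by auto
    then have "w = VF.lincomb (restrict a (\<phi> ` E)) (\<phi> ` E)"
      using VF.lincomb_restrict[OF \<phi>E(1), of a "restrict a (\<phi> ` E)"] by simp
    then show "w \<in> (\<lambda>a. VF.lincomb a (\<phi> ` E)) ` (\<phi> ` E \<rightarrow>\<^sub>E F)"
      using a(1) by (intro image_eqI[of _ _ "restrict a (\<phi> ` E)"]) auto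
  qed
  then have cW: "countable W"
    using countable_PiE_const[OF \<phi>E(2) cF] by (meson countable_image countable_subset)
  define f where "f = to_nat_on F"
  define g where "g = to_nat_on W"
  have f: "inj_on f F" and g: "inj_on g W"
    unfolding f_def g_def using cF cW by (auto intro: inj_on_to_nat_on)
  define K' :: "nat ring" where "K' = image_ring f ?KF"
  define V' :: "(nat, nat) module" where
    "V' = \<lparr>carrier = g ` W, mult = \<lambda>x y. 0, one = 0, zero = g \<zero>\<^bsub>V\<^esub>,
      add = \<lambda>x y. g (inv_into W g x \<oplus>\<^bsub>V\<^esub> inv_into W g y),
      smult = \<lambda>a x. g (inv_into F f a \<odot>\<^bsub>V\<^esub> inv_into W g x)\<rparr>"
  have carrK': "carrier K' = f ` F" "\<zero>\<^bsub>K'\<^esub> = f \<zero>\<^bsub>K\<^esub>" "\<one>\<^bsub>K'\<^esub> = f \<one>\<^bsub>K\<^esub>"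
    unfolding K'_def by (simp_all add: image_ring_carrier image_ring_zero image_ring_one)
  have K'_op: "f a \<otimes>\<^bsub>K'\<^esub> f b = f (a \<otimes>\<^bsub>K\<^esub> b)" "f a \<oplus>\<^bsub>K'\<^esub> f b = f (a \<oplus>\<^bsub>K\<^esub> b)"
    if "a \<in> F" "b \<in> F" for a b
    unfolding K'_def using image_ring_field(2,3)[OF KF, of f a b] f that by auto
  have carrV': "carrier V' = g ` W" "\<zero>\<^bsub>V'\<^esub> = g \<zero>\<^bsub>V\<^esub>" by (simp_all add: V'_def)
  have V'_add: "g v \<oplus>\<^bsub>V'\<^esub> g w = g (v \<oplus>\<^bsub>V\<^esub> w)" if "v \<in> W" "w \<in> W" for v w
    using that g by (simp add: V'_def)
  have V'_smult: "f a \<odot>\<^bsub>V'\<^esub> g v = g (a \<odot>\<^bsub>V\<^esub> v)" if "a \<in> F" "v \<in> W" for a v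
    using that f g by (simp add: V'_def)
  have Wadd: "v \<oplus>\<^bsub>V\<^esub> w \<in> W" if "v \<in> W" "w \<in> W" for v w
    using VW.M.a_closed[of v w] that by simp
  have Wsmult: "a \<odot>\<^bsub>V\<^esub> v \<in> W" if "a \<in> F" "v \<in> W" for a v
    using VW.smult_closed[of a v] that by simp
  have W0: "\<zero>\<^bsub>V\<^esub> \<in> W" using VW.M.zero_closed by simp
  have Wneg: "\<exists>w\<in>W. v \<oplus>\<^bsub>V\<^esub> w = \<zero>\<^bsub>V\<^esub>" if "v \<in> W" for v
    using VW.M.r_neg[of v] VW.M.a_inv_closed[of v] that by auto
  have K': "field K'" unfolding K'_def using image_ring_field(1)[OF KF] f by simp
  have WVD: "v \<in> carrier V" if "v \<in> W" for v using that WV by auto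
  have FKD: "a \<in> carrier K" if "a \<in> F" for a using that FK by auto
  have VS': "vectorspace K' V'"
  proof (rule vs_criteria[OF K'])
    show "\<forall>v\<in>carrier V'. \<exists>neg_v\<in>carrier V'. v \<oplus>\<^bsub>V'\<^esub> neg_v = \<zero>\<^bsub>V'\<^esub>"
      using Wneg V'_add unfolding carrV' by (metis (no_types, lifting) imageE imageI)
  qed (auto simp: carrV' carrK' K'_op V'_add V'_smult Wadd Wsmult W0 F0 Fadd Fmult WVD FKD
      V.M.a_ac V.smult_l_distr V.smult_r_distr V.smult_assoc1)
  have "represents K' V' (g \<circ> \<phi>) (E, indep)"
    unfolding represents_def prod.case
  proof (intro conjI allI impI)
    show "g \<circ> \<phi> \<in> E \<rightarrow> carrier V'" using \<phi>W by (auto simp: carrV')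
    fix X assume X: "X \<subseteq> E"
    have "matroid_rank indep X = card (B X)"
      using rk[OF X] V.dim_span_eq_card[of "\<phi> ` X" "B X"] B[OF X] carr[OF X] by simp
    also have "\<dots> = vectorspace.dim K' (V'\<lparr>carrier := LinearCombinations.module.span K' V' (g ` \<phi> ` X)\<rparr>)"
    proof (rule dim_span_transfer[OF VS VS' FK WV carrK'(1)[symmetric] carrV'(1)[symmetric]
            f F0(1) carrK'(2)[symmetric] g W0 carrV'(2)[symmetric], symmetric])
      show "\<exists>c\<in>B X \<rightarrow> F. s = V.lincomb c (B X)" if "s \<in> \<phi> ` X" for s
        using that c[OF X] cC[OF X] by blast
      show "\<phi> ` X \<subseteq> W" using \<phi>W X by blast
    qed (use Wadd Wsmult V'_add V'_smult B[OF X] carr[OF X] in auto)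
    finally show "matroid_rank indep X =
        vectorspace.dim K' (V'\<lparr>carrier := LinearCombinations.module.span K' V' ((g \<circ> \<phi>) ` X)\<rparr>)"
      by (simp add: image_comp)
  qed (fact VS')
  then show ?thesis using assms(1) unfolding representable_matroids_def by blast
qed

end

theory Submission
  imports Defs "Jordan_Normal_Form.VS_Connect" "HOL-Library.Z2"
begin

text \<open>Every representable matroid satisfies all Kinser inequalities because they hold for the dimensions
of subspaces \<open>V\<^sub>1, \<dots>, V\<^sub>n\<close>, and this uses only that dimension is monotone and modular:
\<open>dim (A + B) + dim (A \<inter> B) = dim A + dim B\<close>. Put \<open>U\<^sub>i = V\<^sub>2 \<inter> V\<^sub>i\<close>. Modularity rewrites the
terms of the inequality that involve \<open>V\<^sub>2\<close> in terms of \<open>dim U\<^sub>i\<close> and of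
\<open>dim (V\<^sub>2 \<inter> (V\<^sub>i\<^sub>-\<^sub>1 + V\<^sub>i)) \<ge> dim (U\<^sub>i\<^sub>-\<^sub>1 + U\<^sub>i)\<close>; the resulting sum telescopes along
\<open>U\<^sub>3, \<dots>, U\<^sub>n\<close> (\<open>chain_inequality\<close>) and leaves the error term \<open>dim Z\<close> with
\<open>Z = V\<^sub>2 \<inter> V\<^sub>3 \<inter> V\<^sub>n\<close>. The terms that involve \<open>V\<^sub>1\<close> absorb it, since
\<open>V\<^sub>1 + Z \<subseteq> (V\<^sub>1 + V\<^sub>3) \<inter> (V\<^sub>1 + V\<^sub>n)\<close> (\<open>kinser\<close>).

The inclusion is proper because the class is closed under direct sums while representability is
not. The Kinser inequalities are linear in the rank function, and the rank function of a direct sum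
is the sum of those of the summands (\<open>kinser_class_infinity_direct_sum\<close>). Take the seven
vectors of the Fano plane, that is \<open>e\<^sub>1, e\<^sub>2, e\<^sub>3\<close> and their sums without repetition, once over
the field with two elements and once over the rationals. Both matroids satisfy the same collinearity
conditions (\<open>fano_frame\<close>), which determine the seven vectors of any representation up to
scaling and choice of basis. Hence over every field the points \<open>e\<^sub>1 + e\<^sub>2\<close>, \<open>e\<^sub>1 + e\<^sub>3\<close>, \<open>e\<^sub>2 + e\<^sub>3\<close> are
collinear exactly when the characteristic is two (\<open>fano_frame_char_two_iff\<close>). A field that
represents the direct sum would represent both summands, and so would have and not have
characteristic two.\<close>

section \<open>Kinser's inequality for modular dimension functions\<close>

text \<open>The part of the subspace lattice that Kinser's inequality needs: \<open>join\<close> stands for the sum of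
subspaces, which is the span of the union and thus not a union of sets.\<close>

locale modular_family =
  fixes L :: "'v set set" and join :: "'v set \<Rightarrow> 'v set \<Rightarrow> 'v set" and d :: "'v set \<Rightarrow> nat"
  assumes inter_closed: "A \<in> L \<Longrightarrow> B \<in> L \<Longrightarrow> A \<inter> B \<in> L"
    and join_closed: "A \<in> L \<Longrightarrow> B \<in> L \<Longrightarrow> join A B \<in> L"
    and join_upper1: "A \<in> L \<Longrightarrow> B \<in> L \<Longrightarrow> A \<subseteq> join A B"
    and join_upper2: "A \<in> L \<Longrightarrow> B \<in> L \<Longrightarrow> B \<subseteq> join A B"
    and join_least: "A \<in> L \<Longrightarrow> B \<in> L \<Longrightarrow> C \<in> L \<Longrightarrow> A \<subseteq> C \<Longrightarrow> B \<subseteq> C \<Longrightarrow> join A B \<subseteq> C"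
    and d_mono: "A \<in> L \<Longrightarrow> B \<in> L \<Longrightarrow> A \<subseteq> B \<Longrightarrow> d A \<le> d B"
    and d_modular: "A \<in> L \<Longrightarrow> B \<in> L \<Longrightarrow> d (join A B) + d (A \<inter> B) = d A + d B"
begin

lemma d_join_le:
  assumes "A \<in> L" "B \<in> L" "D \<in> L" "D \<subseteq> A" "D \<subseteq> B"
  shows "d (join A B) + d D \<le> d A + d B"
proof -
  have "d D \<le> d (A \<inter> B)" using assms by (intro d_mono inter_closed) auto
  then show ?thesis using d_modular[of A B] assms by linarith
qed

lemma d_le_inter:
  assumes "A \<in> L" "B \<in> L" "C \<in> L" "A \<subseteq> C" "B \<subseteq> C"
  shows "d A + d B \<le> d C + d (A \<inter> B)"
proof -
  have "d (join A B) \<le> d C" using assms by (intro d_mono join_closed join_least) auto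
  then show ?thesis using d_modular[of A B] assms by linarith
qed

text \<open>By induction on \<open>n\<close>. Passing from \<open>n\<close> to \<open>n + 1\<close> changes the error term from
\<open>d (U\<^sub>3 \<inter> U\<^sub>n)\<close> to \<open>d (U\<^sub>3 \<inter> U\<^sub>n\<^sub>+\<^sub>1)\<close>, where \<open>U\<^sub>i = V 2 \<inter> V i\<close>; the step comes down to
\<open>d (U\<^sub>3 \<inter> U\<^sub>n) + d (U\<^sub>n \<inter> U\<^sub>n\<^sub>+\<^sub>1) \<le> d U\<^sub>n + d (U\<^sub>3 \<inter> U\<^sub>n\<^sub>+\<^sub>1)\<close>, a consequence of modularity
inside \<open>U\<^sub>n\<close>.\<close>

lemma chain_inequality:
  fixes n :: nat
  assumes V: "\<And>i. i \<in> {2..n} \<Longrightarrow> V i \<in> L" and "3 \<le> n"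
  shows "(\<Sum>i=3..n. d (V i)) + (\<Sum>i=4..n. d (join (join (V 2) (V (i - 1))) (V i))) + d (V 2)
    \<le> (\<Sum>i=3..n. d (join (V 2) (V i))) + (\<Sum>i=4..n. d (join (V (i - 1)) (V i)))
      + d (V 2 \<inter> V 3 \<inter> V n)"
  using \<open>3 \<le> n\<close> V
proof (induction n rule: dec_induct)
  case base
  then show ?case using d_modular[of "V 2" "V 3"] by (simp add: Int_assoc)
next
  case (step n)
  let ?A = "V 2" and ?B = "V n" and ?C = "V (Suc n)"
  have L: "?A \<in> L" "?B \<in> L" "?C \<in> L" "V 3 \<in> L" using step by auto
  note closed = inter_closed join_closed L
  have "join (join ?A ?B) ?C \<subseteq> join ?A (join ?B ?C)"
    using join_upper1[of ?A "join ?B ?C"] join_upper2[of ?A "join ?B ?C"]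
      join_upper1[of ?B ?C] join_upper2[of ?B ?C] by (intro join_least closed) (auto simp: closed)
  then have 1: "d (join (join ?A ?B) ?C) \<le> d (join ?A (join ?B ?C))"
    by (intro d_mono closed)
  have 2: "d (join ?A (join ?B ?C)) + d (?A \<inter> join ?B ?C) = d ?A + d (join ?B ?C)"
    by (intro d_modular closed)
  have 3: "d (?A \<inter> ?B) + d (?A \<inter> ?C) \<le> d (?A \<inter> join ?B ?C) + d ((?A \<inter> ?B) \<inter> (?A \<inter> ?C))"
    using join_upper1[of ?B ?C] join_upper2[of ?B ?C]
    by (intro d_le_inter closed) (auto simp: closed)
  have 4: "d (join ?A ?C) + d (?A \<inter> ?C) = d ?A + d ?C"
    by (intro d_modular closed)
  let ?P = "(?A \<inter> ?B) \<inter> (?A \<inter> ?C)" and ?Q = "?A \<inter> V 3 \<inter> ?B"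
  have 5: "d ?P + d ?Q \<le> d (?A \<inter> ?B) + d (?P \<inter> ?Q)"
    by (rule d_le_inter) (auto intro!: closed)
  have 6: "d (?P \<inter> ?Q) \<le> d (?A \<inter> V 3 \<inter> ?C)"
    by (rule d_mono) (auto intro!: closed)
  have IH: "(\<Sum>i=3..n. d (V i)) + (\<Sum>i=4..n. d (join (join (V 2) (V (i - 1))) (V i))) + d (V 2)
    \<le> (\<Sum>i=3..n. d (join (V 2) (V i))) + (\<Sum>i=4..n. d (join (V (i - 1)) (V i)))
      + d (V 2 \<inter> V 3 \<inter> V n)"
    using step by simp
  have "3 \<le> Suc n" "4 \<le> Suc n" using step by auto
  then show ?case
    using IH 1 2 3 4 5 6 by (simp add: sum.nat_ivl_Suc')
qed

text \<open>It remains to bound the error term \<open>d Z\<close> of the chain inequality by the terms that contain \<open>V 1\<close>.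
The sum \<open>V 1 + Z\<close> links them: it lies in both \<open>V 1 + V 3\<close> and \<open>V 1 + V n\<close>, and \<open>Z\<close> lies in both
\<open>V 2\<close> and \<open>V 1 + Z\<close>.\<close>

lemma kinser:
  fixes n :: nat
  assumes V: "\<And>i. i \<in> {1..n} \<Longrightarrow> V i \<in> L" and "4 \<le> n"
  shows "(\<Sum>i=3..n. d (V i)) + d (join (V 1) (V 2)) + d (join (join (V 1) (V 3)) (V n))
      + (\<Sum>i=4..n. d (join (join (V 2) (V (i - 1))) (V i)))
    \<le> d (join (V 1) (V 3)) + d (join (V 1) (V n)) + (\<Sum>i=3..n. d (join (V 2) (V i)))
      + (\<Sum>i=4..n. d (join (V (i - 1)) (V i)))"
proof -
  let ?Z = "V 2 \<inter> V 3 \<inter> V n"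
  have L: "V 1 \<in> L" "V 2 \<in> L" "V 3 \<in> L" "V n \<in> L" using assms by auto
  note closed = inter_closed join_closed L
  have Z: "?Z \<in> L" by (intro closed)
  note up = join_upper1[of "V 1"] join_upper2[of "V 1"]
  have "d (join (V 1) (V 2)) \<le> d (join (V 2) (join (V 1) ?Z))"
    using join_upper1[of "V 2" "join (V 1) ?Z"] join_upper2[of "V 2" "join (V 1) ?Z"]
      up(1)[of ?Z] L Z
    by (intro d_mono join_least closed) (auto simp: closed)
  moreover have "d (join (V 2) (join (V 1) ?Z)) + d ?Z \<le> d (V 2) + d (join (V 1) ?Z)"
    using up(2)[of ?Z] L Z
    by (intro d_join_le closed) auto
  moreover have "join (join (V 1) (V 3)) (V n)
      \<subseteq> join (join (V 1) (V 3)) (join (V 1) (V n))"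
    using join_upper2[of "join (V 1) (V 3)" "join (V 1) (V n)"] up(2)[of "V n"] L
    by (intro join_least[of "join (V 1) (V 3)"] join_upper1 closed) (auto simp: closed)
  then have "d (join (join (V 1) (V 3)) (V n))
      \<le> d (join (join (V 1) (V 3)) (join (V 1) (V n)))"
    by (intro d_mono closed)
  moreover have "d (join (join (V 1) (V 3)) (join (V 1) (V n))) + d (join (V 1) ?Z)
      \<le> d (join (V 1) (V 3)) + d (join (V 1) (V n))"
    using up(1,2)[of "V 3"] up(1,2)[of "V n"] L Z
    by (intro d_join_le closed join_least) auto
  ultimately show ?thesis
    using chain_inequality[of n V] assms by simp
qed

end

section \<open>Subspaces of a vector space as a modular family\<close>

context vectorspace
begin

lemma span_submodule_eq:
  assumes "submodule K N V"
  shows "span N = N"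
  using span_is_subset[OF subset_refl assms] in_own_span submodule.subset[OF assms] by blast

text \<open>The space itself may have infinite dimension, so finiteness is measured by a finite set \<open>S\<close> whose
span contains the subspace: it bounds the size of independent sets, and an independent set of
maximal size spans.\<close>

lemma extend_to_basis:
  assumes S: "finite S" "S \<subseteq> carrier V" "N \<subseteq> span S"
    and N: "submodule K N V" and C: "C \<subseteq> N" "lin_indpt C" "finite C"
  obtains B where "C \<subseteq> B" "B \<subseteq> N" "finite B" "lin_indpt B" "span B = N"
proof -
  have NV: "N \<subseteq> carrier V" using submodule.subset[OF N] .
  define P where "P B \<longleftrightarrow> C \<subseteq> B \<and> B \<subseteq> N \<and> finite B \<and> lin_indpt B" for B
  \<comment> \<open>Exchange: an independent set inside a span is no larger than the spanning set.\<close>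
  have bound: "card B < Suc (card S)" if B: "P B" for B
  proof -
    have "B \<subseteq> span S" "finite B" "lin_indpt B" using B S(3) by (auto simp: P_def)
    then show ?thesis using replacement[OF _ S(1,2), of B] by fastforce
  qed
  have "P C" using C by (simp add: P_def)
  then have "\<exists>B. P B \<and> (\<forall>B'. P B' \<longrightarrow> card B' \<le> card B)"
    by (rule ex_has_greatest_nat) (use bound in blast)
  then obtain B where B: "P B" "\<And>B'. P B' \<Longrightarrow> card B' \<le> card B"
    by blast
  have BV: "B \<subseteq> carrier V" using B(1) NV by (auto simp: P_def)
  have "N \<subseteq> span B"
  proof
    fix x assume x: "x \<in> N"
    show "x \<in> span B"
    proof (rule ccontr)
      assume nx: "x \<notin> span B"
      then have "x \<notin> B" using in_own_span[OF BV] by auto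
      moreover from this have "lin_indpt (B \<union> {x})"
        using lin_dep_iff_in_span[OF BV _ _ \<open>x \<notin> B\<close>] nx B(1) x NV by (auto simp: P_def)
      then have "P (B \<union> {x})" using B(1) x by (auto simp: P_def)
      ultimately show False using B(2)[of "B \<union> {x}"] B(1) by (auto simp: P_def)
    qed
  qed
  moreover have "span B \<subseteq> N" using span_is_subset[OF _ N] B(1) by (auto simp: P_def)
  ultimately have "span B = N" by (rule subset_antisym[rotated])
  then show ?thesis using that[of B] B(1) unfolding P_def by blast
qed

lemma mem_span_Un_submodules:
  assumes A: "submodule K A V" and B: "submodule K B V" and v: "v \<in> span (A \<union> B)"
  obtains a b where "a \<in> A" "b \<in> B" "v = a \<oplus>\<^bsub>V\<^esub> b"
proof -
  have "span (A \<union> B) \<subseteq> submodule_sum A B"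
    using in_sum[OF A B] in_sum[OF B A] msum_comm[OF A B]
    by (intro span_is_subset sum_is_submodule A B) auto
  then show ?thesis using v that unfolding submodule_sum_def by auto
qed

lemma span_span_Un:
  assumes "A \<subseteq> carrier V" "B \<subseteq> carrier V"
  shows "span (span A \<union> span B) = span (A \<union> B)"
  using assms span_is_submodule[of A] span_is_submodule[of B]
  by (intro span_Un) (auto simp: span_submodule_eq intro: submodule.subset[THEN subsetD])

text \<open>The core of the modular law. Elements of \<open>P - C\<close> are added to \<open>Q\<close> one by one. If such an \<open>x\<close> were
\<open>u + w\<close> with \<open>u\<close> in the span of the previous elements \<open>D\<close> and \<open>w\<close> in the span of \<open>Q\<close>, then
\<open>w = x - u\<close> would lie in both spans, hence in that of \<open>C\<close>, and \<open>x\<close> would depend on \<open>D \<union> C\<close>, a part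
of \<open>P - {x}\<close>.\<close>

lemma indpt_Un_of_trivial_overlap:
  assumes P: "finite P" "P \<subseteq> carrier V" "lin_indpt P" and "C \<subseteq> P"
    and Q: "finite Q" "Q \<subseteq> carrier V" "lin_indpt Q"
    and int: "span P \<inter> span Q \<subseteq> span C"
    and D: "D \<subseteq> P - C"
  shows "lin_indpt (D \<union> Q) \<and> D \<inter> Q = {}"
proof -
  have "finite D" using D P(1) finite_subset by blast
  then show ?thesis using D
  proof (induction D rule: finite_induct)
    case empty
    then show ?case using Q by simp
  next
    case (insert x D)
    have DV: "D \<subseteq> carrier V" and xP: "x \<in> P" and xV: "x \<in> carrier V" and DQ: "D \<union> Q \<subseteq> carrier V"
      and CV: "C \<subseteq> carrier V"
      using insert.prems P Q assms(4) by auto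
    have "x \<notin> span (D \<union> Q)"
    proof
      assume "x \<in> span (D \<union> Q)"
      then have "x \<in> span (span D \<union> span Q)" using span_span_Un[OF DV Q(2)] by simp
      then obtain u w where u: "u \<in> span D" and w: "w \<in> span Q" and x: "x = u \<oplus>\<^bsub>V\<^esub> w"
        using mem_span_Un_submodules[OF span_is_submodule[OF DV] span_is_submodule[OF Q(2)]] by metis
      have wV: "w \<in> carrier V" using w Q(2) by auto
      have "u \<in> span P" using u insert.prems span_is_monotone[of D P] by auto
      then have "w \<in> span P"
        using span_add[OF P(2) _ wV, of u] x xP in_own_span[OF P(2)] by auto
      then have "w \<in> span C" using w int by auto
      then have "x \<in> span (D \<union> C)"
        using x u span_is_monotone[of D "D \<union> C"] span_is_monotone[of C "D \<union> C"]
          span_add1[of "D \<union> C" u w] DV CV by auto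
      moreover have "D \<union> C \<subseteq> P - {x}" using insert assms(4) by auto
      ultimately have "x \<in> span (P - {x})" using span_is_monotone by blast
      then show False using lindep_span[OF P(2,1)] P(3) xP by auto
    qed
    moreover from this have "x \<notin> D \<union> Q" using in_own_span[OF DQ] by auto
    ultimately have "lin_indpt (D \<union> Q \<union> {x})"
      using lin_dep_iff_in_span[OF DQ _ xV] insert by auto
    then show ?case using \<open>x \<notin> D \<union> Q\<close> insert by auto
  qed
qed

lemma dim_span_indpt:
  assumes "finite B" "B \<subseteq> carrier V" "lin_indpt B"
  shows "vectorspace.dim K (vs (span B)) = card B"
  using dim_span_eq_card[of B B] assms in_own_span[of B] by auto

lemma dim_mono_submodule:
  assumes S: "finite S" "S \<subseteq> carrier V" "N \<subseteq> span S"
    and "submodule K M V" "submodule K N V" "M \<subseteq> N"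
  shows "vectorspace.dim K (vs M) \<le> vectorspace.dim K (vs N)"
proof -
  have li: "lin_indpt {}" unfolding lin_dep_def by auto
  obtain B where B: "B \<subseteq> M" "finite B" "lin_indpt B" "span B = M"
    using extend_to_basis[OF S(1,2) subset_trans[OF assms(6) S(3)] assms(4) empty_subsetI li finite.emptyI]
    by metis
  obtain C where C: "B \<subseteq> C" "C \<subseteq> N" "finite C" "lin_indpt C" "span C = N"
    using extend_to_basis[OF S assms(5) _ B(3,2)] assms(6) B(1) by auto
  have CV: "C \<subseteq> carrier V" using C(2) submodule.subset[OF assms(5)] by (rule subset_trans)
  have "vectorspace.dim K (vs M) = card B"
    using dim_span_indpt[OF B(2) subset_trans[OF C(1) CV] B(3)] B(4) by simp
  moreover have "vectorspace.dim K (vs N) = card C"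
    using dim_span_indpt[OF C(3) CV C(4)] C(5) by simp
  ultimately show ?thesis using card_mono[OF C(3,1)] by simp
qed

text \<open>A basis \<open>C\<close> of the intersection is extended to a basis \<open>P\<close> of \<open>A\<close> and to a basis \<open>Q\<close> of \<open>B\<close>; then
\<open>P \<union> Q\<close> is a basis of the sum.\<close>

lemma dim_modular:
  assumes S: "finite S" "S \<subseteq> carrier V" "A \<subseteq> span S" "B \<subseteq> span S"
    and A: "submodule K A V" and B: "submodule K B V"
  shows "vectorspace.dim K (vs (span (A \<union> B))) + vectorspace.dim K (vs (A \<inter> B))
    = vectorspace.dim K (vs A) + vectorspace.dim K (vs B)"
proof -
  have li: "lin_indpt {}" unfolding lin_dep_def by auto
  have AV: "A \<subseteq> carrier V" and BV: "B \<subseteq> carrier V"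
    using submodule.subset A B by auto
  have AB: "submodule K (A \<inter> B) V" using A B unfolding submodule_def by auto
  obtain C where C: "C \<subseteq> A \<inter> B" "finite C" "lin_indpt C" "span C = A \<inter> B"
    using extend_to_basis[OF S(1,2) le_infI1[OF S(3)] AB empty_subsetI li finite.emptyI] by metis
  obtain P where P: "C \<subseteq> P" "P \<subseteq> A" "finite P" "lin_indpt P" "span P = A"
    using extend_to_basis[OF S(1,2,3) A _ C(3,2)] C(1) by auto
  obtain Q where Q: "C \<subseteq> Q" "Q \<subseteq> B" "finite Q" "lin_indpt Q" "span Q = B"
    using extend_to_basis[OF S(1,2,4) B _ C(3,2)] C(1) by auto
  have PV: "P \<subseteq> carrier V" and QV: "Q \<subseteq> carrier V" using P Q AV BV by auto
  have R: "lin_indpt (P - C \<union> Q)" "(P - C) \<inter> Q = {}"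
    using indpt_Un_of_trivial_overlap[OF P(3) PV P(4,1) Q(3) QV Q(4), of "P - C"] P Q C by auto
  have "P - C \<union> Q = P \<union> Q" using Q(1) by auto
  then have "span (P - C \<union> Q) = span (A \<union> B)"
    using span_span_Un[OF PV QV] P(5) Q(5) by simp
  then have "vectorspace.dim K (vs (span (A \<union> B))) = card (P - C \<union> Q)"
    using dim_span_indpt[of "P - C \<union> Q"] R(1) P(3) Q(3) PV QV by (simp add: le_infI1 Diff_subset[THEN subset_trans])
  also have "\<dots> = card P - card C + card Q"
    using R(2) P Q C by (simp add: card_Un_disjoint card_Diff_subset)
  finally have "vectorspace.dim K (vs (span (A \<union> B))) = card P - card C + card Q" .
  moreover have "vectorspace.dim K (vs A) = card P"
    using dim_span_indpt[OF P(3) PV P(4)] P(5) by simp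
  moreover have "vectorspace.dim K (vs B) = card Q"
    using dim_span_indpt[OF Q(3) QV Q(4)] Q(5) by simp
  moreover have "vectorspace.dim K (vs (A \<inter> B)) = card C"
    using dim_span_indpt[OF C(2) subset_trans[OF P(1) PV] C(3)] C(4) by simp
  moreover have "card C \<le> card P" by (rule card_mono[OF P(3,1)])
  ultimately show ?thesis by linarith
qed

lemma modular_family_subspaces:
  assumes S: "finite S" "S \<subseteq> carrier V"
  shows "modular_family {N. submodule K N V \<and> N \<subseteq> span S}
    (\<lambda>A B. span (A \<union> B)) (\<lambda>N. vectorspace.dim K (vs N))"
    (is "modular_family ?L _ _")
proof
  fix A B assume "A \<in> ?L" "B \<in> ?L"
  then have A: "submodule K A V" "A \<subseteq> span S" and B: "submodule K B V" "B \<subseteq> span S" by simp_all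
  have V: "A \<union> B \<subseteq> carrier V" using submodule.subset[OF A(1)] submodule.subset[OF B(1)] by blast
  have "submodule K (A \<inter> B) V" using A(1) B(1) unfolding submodule_def by auto
  then show "A \<inter> B \<in> ?L" using A(2) by blast
  have "span (A \<union> B) \<subseteq> span S"
    using A(2) B(2) by (intro span_is_subset span_is_submodule S(2)) simp
  then show "span (A \<union> B) \<in> ?L" using span_is_submodule[OF V] by simp
  show "A \<subseteq> span (A \<union> B)" "B \<subseteq> span (A \<union> B)" using in_own_span[OF V] by simp_all
  show "span (A \<union> B) \<subseteq> C" if "C \<in> ?L" "A \<subseteq> C" "B \<subseteq> C" for C
    using that by (intro span_is_subset) simp_all
  show "vectorspace.dim K (vs A) \<le> vectorspace.dim K (vs B)" if "A \<subseteq> B"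
    by (rule dim_mono_submodule[OF S B(2) A(1) B(1) that])
  show "vectorspace.dim K (vs (span (A \<union> B))) + vectorspace.dim K (vs (A \<inter> B))
    = vectorspace.dim K (vs A) + vectorspace.dim K (vs B)"
    by (rule dim_modular[OF S A(2) B(2) A(1) B(1)])
qed

end

theorem represents_imp_kinser:
  assumes M: "matroid E indep" and rep: "represents K V \<phi> (E, indep)"
  shows "(E, indep) \<in> kinser_class_infinity"
proof -
  have rep': "vectorspace K V" "\<phi> \<in> E \<rightarrow> carrier V" "\<And>X. X \<subseteq> E \<Longrightarrow> matroid_rank indep X =
      vectorspace.dim K (V\<lparr>carrier := LinearCombinations.module.span K V (\<phi> ` X)\<rparr>)"
    using rep by (simp_all add: represents_def)
  interpret vectorspace K V by (rule rep'(1))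
  have E: "finite (\<phi> ` E)" "\<phi> ` E \<subseteq> carrier V"
    using rep'(2) matroid.finite_ground[OF M] by (simp_all add: image_subset_iff_funcset)
  interpret F: modular_family "{N. submodule K N V \<and> N \<subseteq> span (\<phi> ` E)}"
      "\<lambda>A B. span (A \<union> B)" "\<lambda>N. vectorspace.dim K (vs N)"
    by (rule modular_family_subspaces[OF E])
  have "kinser_inequality n (matroid_rank indep) X"
    if n: "4 \<le> n" and X: "\<And>i. i \<in> {1..n} \<Longrightarrow> X i \<subseteq> E" for n X
  proof -
    define W where "W i = span (\<phi> ` X i)" for i
    have XV: "\<phi> ` X i \<subseteq> carrier V" if "i \<in> {1..n}" for i using X[OF that] E(2) by blast
    have W: "W i \<in> {N. submodule K N V \<and> N \<subseteq> span (\<phi> ` E)}" if "i \<in> {1..n}" for i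
      using span_is_submodule[OF XV[OF that]] span_is_monotone[of "\<phi> ` X i" "\<phi> ` E"] X[OF that]
      unfolding W_def by blast
    note r = rep'(3)
    have r1: "matroid_rank indep (X i) = vectorspace.dim K (vs (W i))" if "i \<in> {1..n}" for i
      using r X[OF that] by (simp add: W_def)
    have r2: "matroid_rank indep (X i \<union> X j) = vectorspace.dim K (vs (span (W i \<union> W j)))"
      if "i \<in> {1..n}" "j \<in> {1..n}" for i j
      using r[of "X i \<union> X j"] X that XV span_span_Un[of "\<phi> ` X i" "\<phi> ` X j"]
      by (simp add: W_def image_Un)
    have r3: "matroid_rank indep (X i \<union> X j \<union> X k)
        = vectorspace.dim K (vs (span (span (W i \<union> W j) \<union> W k)))"
      if "i \<in> {1..n}" "j \<in> {1..n}" "k \<in> {1..n}" for i j k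
      using r[of "X i \<union> X j \<union> X k"] X that XV span_span_Un[of "\<phi> ` X i" "\<phi> ` X j"]
        span_span_Un[of "\<phi> ` X i \<union> \<phi> ` X j" "\<phi> ` X k"]
      by (simp add: W_def image_Un)
    let ?d = "\<lambda>N. vectorspace.dim K (vs N)"
    have s1: "(\<Sum>i=3..n. matroid_rank indep (X i)) = (\<Sum>i=3..n. ?d (W i))"
      by (rule sum.cong[OF refl], rule r1) auto
    have s2: "(\<Sum>i=3..n. matroid_rank indep (X 2 \<union> X i)) = (\<Sum>i=3..n. ?d (span (W 2 \<union> W i)))"
      by (rule sum.cong[OF refl], rule r2) auto
    have s3: "(\<Sum>i=4..n. matroid_rank indep (X (i - 1) \<union> X i))
        = (\<Sum>i=4..n. ?d (span (W (i - 1) \<union> W i)))"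
      by (rule sum.cong[OF refl], rule r2) auto
    have s4: "(\<Sum>i=4..n. matroid_rank indep (X 2 \<union> X (i - 1) \<union> X i))
        = (\<Sum>i=4..n. ?d (span (span (W 2 \<union> W (i - 1)) \<union> W i)))"
      by (rule sum.cong[OF refl], rule r3) auto
    have ix: "1 \<in> {1..n}" "2 \<in> {1..n}" "3 \<in> {1..n}" "n \<in> {1..n}" using n by auto
    show ?thesis
      unfolding kinser_inequality_def s1 s2 s3 s4 r2[OF ix(1,2)] r2[OF ix(1,3)] r2[OF ix(1,4)]
        r3[OF ix(1,3,4)]
      by (rule F.kinser[OF W n])
  qed
  then show ?thesis
    using M by (auto simp: kinser_class_infinity_def kinser_class_def)
qed

section \<open>Vector matroids and direct sums\<close>

lemma matroid_rank_eqI: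
  assumes "finite X" "I \<subseteq> X" "indep I"
    and "\<And>J. J \<subseteq> X \<Longrightarrow> indep J \<Longrightarrow> card J \<le> card I"
  shows "matroid_rank indep X = card I"
  unfolding matroid_rank_def
proof (rule Max_eqI)
  show "finite (card ` {I. I \<subseteq> X \<and> indep I})" using assms(1) by simp
qed (use assms in auto)

lemma matroid_rank_Int_ground:
  assumes "matroid E indep"
  shows "matroid_rank indep (X \<inter> E) = matroid_rank indep X"
proof -
  have "{I. I \<subseteq> X \<inter> E \<and> indep I} = {I. I \<subseteq> X \<and> indep I}"
    using matroid.indep_subset_ground[OF assms] by auto
  then show ?thesis by (simp add: matroid_rank_def)
qed

lemma (in matroid) matroid_rank_witness:
  obtains I where "I \<subseteq> X" "indep I" "card I = matroid_rank indep X"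
    "\<And>J. J \<subseteq> X \<Longrightarrow> indep J \<Longrightarrow> card J \<le> card I"
proof -
  let ?A = "card ` {I. I \<subseteq> X \<and> indep I}"
  have fin: "finite ?A"
    using finite_subset[of "{I. I \<subseteq> X \<and> indep I}" "Pow E"] finite_ground indep_subset_ground by auto
  have "?A \<noteq> {}" using indep_empty by auto
  from Max_in[OF fin this] obtain I where "I \<subseteq> X" "indep I" "card I = Max ?A" by auto
  then show ?thesis using Max_ge[OF fin] that[of I] unfolding matroid_rank_def by auto
qed

text \<open>Injectivity makes two parallel elements, which \<open>\<phi>\<close> may send to the same vector, a dependent pair.\<close>

definition vector_indep ::
  "('k, 'm) ring_scheme \<Rightarrow> ('k, 'v, 'n) module_scheme \<Rightarrow> ('a \<Rightarrow> 'v) \<Rightarrow> 'a set \<Rightarrow> 'a set \<Rightarrow> bool" where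
  "vector_indep K V \<phi> E I \<longleftrightarrow>
     I \<subseteq> E \<and> inj_on \<phi> I \<and> \<not> LinearCombinations.module.lin_dep K V (\<phi> ` I)"

context vectorspace
begin

lemma card_le_of_indpt_in_span:
  assumes "finite A" "finite B" "B \<subseteq> carrier V" "lin_indpt A" "A \<subseteq> span B"
  shows "card A \<le> card B"
  using replacement[OF assms] by fastforce

lemma vector_matroid:
  assumes E: "finite E" and \<phi>: "\<phi> \<in> E \<rightarrow> carrier V"
  shows "matroid E (vector_indep K V \<phi> E)"
proof
  show "vector_indep K V \<phi> E {}" by (simp add: vector_indep_def lin_dep_def)
next
  fix I J assume "vector_indep K V \<phi> E I" "J \<subseteq> I"
  then show "vector_indep K V \<phi> E J"
    unfolding vector_indep_def using subset_li_is_li[of "\<phi> ` I" "\<phi> ` J"] inj_on_subset by blast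
next
  fix I J assume I: "vector_indep K V \<phi> E I" and J: "vector_indep K V \<phi> E J" and less: "card I < card J"
  have fin: "finite I" "finite J" using I J E finite_subset by (auto simp: vector_indep_def)
  have V: "\<phi> ` I \<subseteq> carrier V" "\<phi> ` J \<subseteq> carrier V" using I J \<phi> by (auto simp: vector_indep_def)
  have "card (\<phi> ` I) < card (\<phi> ` J)"
    using I J less by (simp add: vector_indep_def card_image)
  then have "\<not> \<phi> ` J \<subseteq> span (\<phi> ` I)"
    using card_le_of_indpt_in_span[of "\<phi> ` J" "\<phi> ` I"] fin V J by (auto simp: vector_indep_def)
  then obtain x where x: "x \<in> J" "\<phi> x \<notin> span (\<phi> ` I)" by auto
  then have nI: "\<phi> x \<notin> \<phi> ` I" using in_own_span[OF V(1)] by auto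
  then have "lin_indpt (\<phi> ` I \<union> {\<phi> x})"
    using lin_dep_iff_in_span[OF V(1) _ _ nI] I x V(2) by (auto simp: vector_indep_def)
  then have "vector_indep K V \<phi> E (insert x I)"
    using I J x(1) nI by (auto simp: vector_indep_def)
  then show "\<exists>x\<in>J - I. vector_indep K V \<phi> E (insert x I)" using x(1) nI by blast
qed (use E in \<open>auto simp: vector_indep_def\<close>)

lemma vector_matroid_represented:
  assumes E: "finite E" and \<phi>: "\<phi> \<in> E \<rightarrow> carrier V"
  shows "represents K V \<phi> (E, vector_indep K V \<phi> E)"
  unfolding represents_def prod.case
proof (intro conjI allI impI)
  fix X assume X: "X \<subseteq> E"
  have fX: "finite X" using X E finite_subset by auto
  have V: "\<phi> ` X \<subseteq> carrier V" using X \<phi> by auto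
  obtain B where B: "B \<subseteq> \<phi> ` X" "lin_indpt B" "\<phi> ` X \<subseteq> span B"
    using ex_indep_spanning_subset[of "\<phi> ` X"] fX V by auto
  obtain I where I: "I \<subseteq> X" "inj_on \<phi> I" "B = \<phi> ` I"
    using B(1) by (auto simp: subset_image_inj)
  have "matroid_rank (vector_indep K V \<phi> E) X = card I"
  proof (rule matroid_rank_eqI[OF fX I(1)])
    show "vector_indep K V \<phi> E I" using I B X by (auto simp: vector_indep_def)
    fix J assume J: "J \<subseteq> X" "vector_indep K V \<phi> E J"
    have "card (\<phi> ` J) \<le> card B"
      using card_le_of_indpt_in_span[of "\<phi> ` J" B] J(2) subset_trans[OF image_mono[OF J(1)] B(3)]
        B(1) V fX finite_subset[OF J(1)] finite_subset[OF B(1)]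
      by (auto simp: vector_indep_def)
    then show "card J \<le> card I" using J(2) I by (simp add: vector_indep_def card_image)
  qed
  then show "matroid_rank (vector_indep K V \<phi> E) X = vectorspace.dim K (vs (span (\<phi> ` X)))"
    using dim_span_eq_card[of "\<phi> ` X" B] fX V B I by (simp add: card_image)
qed (use \<phi> in \<open>auto simp: vectorspace_axioms\<close>)

end

definition direct_sum_indep ::
  "'a set \<Rightarrow> ('a set \<Rightarrow> bool) \<Rightarrow> 'a set \<Rightarrow> ('a set \<Rightarrow> bool) \<Rightarrow> 'a set \<Rightarrow> bool" where
  "direct_sum_indep E1 indep1 E2 indep2 I \<longleftrightarrow>
     I \<subseteq> E1 \<union> E2 \<and> indep1 (I \<inter> E1) \<and> indep2 (I \<inter> E2)"

lemma card_eq_sum_of_traces: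
  assumes "finite I" "I \<subseteq> A \<union> B" "A \<inter> B = {}"
  shows "card I = card (I \<inter> A) + card (I \<inter> B)"
proof -
  have "card ((I \<inter> A) \<union> (I \<inter> B)) = card (I \<inter> A) + card (I \<inter> B)"
    using assms by (intro card_Un_disjoint) auto
  moreover have "(I \<inter> A) \<union> (I \<inter> B) = I" using assms(2) by auto
  ultimately show ?thesis by simp
qed

lemma direct_sum_matroid:
  assumes M1: "matroid E1 indep1" and M2: "matroid E2 indep2" and disj: "E1 \<inter> E2 = {}"
  shows "matroid (E1 \<union> E2) (direct_sum_indep E1 indep1 E2 indep2)"
proof -
  interpret M1: matroid E1 indep1 by fact
  interpret M2: matroid E2 indep2 by fact
  let ?indep = "direct_sum_indep E1 indep1 E2 indep2"
  show ?thesis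
  proof
    fix I J assume "?indep I" "J \<subseteq> I"
    then show "?indep J"
      unfolding direct_sum_indep_def
      using M1.indep_subset[of "I \<inter> E1" "J \<inter> E1"] M2.indep_subset[of "I \<inter> E2" "J \<inter> E2"] by blast
  next
    fix I J assume I: "?indep I" and J: "?indep J" and less: "card I < card J"
    have "finite I" "finite J"
      using I J M1.finite_ground M2.finite_ground finite_subset by (auto simp: direct_sum_indep_def)
    then have "card (I \<inter> E1) + card (I \<inter> E2) < card (J \<inter> E1) + card (J \<inter> E2)"
      using less card_eq_sum_of_traces[OF _ _ disj] I J by (simp add: direct_sum_indep_def)
    then consider "card (I \<inter> E1) < card (J \<inter> E1)" | "card (I \<inter> E2) < card (J \<inter> E2)" by linarith
    then show "\<exists>x\<in>J - I. ?indep (insert x I)"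
    proof cases
      case 1
      then obtain x where x: "x \<in> J \<inter> E1 - I \<inter> E1" "indep1 (insert x (I \<inter> E1))"
        using M1.indep_augment[of "I \<inter> E1" "J \<inter> E1"] I J by (auto simp: direct_sum_indep_def)
      moreover have "insert x I \<inter> E1 = insert x (I \<inter> E1)" "insert x I \<inter> E2 = I \<inter> E2"
        using x(1) disj by auto
      ultimately have "?indep (insert x I)" using I by (auto simp: direct_sum_indep_def)
      then show ?thesis using x(1) by blast
    next
      case 2
      then obtain x where x: "x \<in> J \<inter> E2 - I \<inter> E2" "indep2 (insert x (I \<inter> E2))"
        using M2.indep_augment[of "I \<inter> E2" "J \<inter> E2"] I J by (auto simp: direct_sum_indep_def)
      moreover have "insert x I \<inter> E2 = insert x (I \<inter> E2)" "insert x I \<inter> E1 = I \<inter> E1"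
        using x(1) disj by auto
      ultimately have "?indep (insert x I)" using I by (auto simp: direct_sum_indep_def)
      then show ?thesis using x(1) by blast
    qed
  qed (use M1.finite_ground M2.finite_ground M1.indep_empty M2.indep_empty
       in \<open>auto simp: direct_sum_indep_def\<close>)
qed

text \<open>Independence in the direct sum is tested on the two traces separately, so a largest independent
subset of \<open>X\<close> is a union of largest independent subsets of the two traces of \<open>X\<close>.\<close>

lemma matroid_rank_direct_sum:
  assumes M1: "matroid E1 indep1" and M2: "matroid E2 indep2" and disj: "E1 \<inter> E2 = {}"
  shows "matroid_rank (direct_sum_indep E1 indep1 E2 indep2) X
    = matroid_rank indep1 (X \<inter> E1) + matroid_rank indep2 (X \<inter> E2)"
proof -
  interpret M1: matroid E1 indep1 by fact
  interpret M2: matroid E2 indep2 by fact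
  let ?indep = "direct_sum_indep E1 indep1 E2 indep2"
  let ?X = "X \<inter> (E1 \<union> E2)"
  obtain I1 where I1: "I1 \<subseteq> X \<inter> E1" "indep1 I1" "card I1 = matroid_rank indep1 (X \<inter> E1)"
    "\<And>J. J \<subseteq> X \<inter> E1 \<Longrightarrow> indep1 J \<Longrightarrow> card J \<le> card I1" using M1.matroid_rank_witness by metis
  obtain I2 where I2: "I2 \<subseteq> X \<inter> E2" "indep2 I2" "card I2 = matroid_rank indep2 (X \<inter> E2)"
    "\<And>J. J \<subseteq> X \<inter> E2 \<Longrightarrow> indep2 J \<Longrightarrow> card J \<le> card I2" using M2.matroid_rank_witness by metis
  have fin: "finite ?X" using M1.finite_ground M2.finite_ground by auto
  have I: "(I1 \<union> I2) \<inter> E1 = I1" "(I1 \<union> I2) \<inter> E2 = I2" "I1 \<union> I2 \<subseteq> ?X"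
    using I1(1) I2(1) disj by auto
  have card: "card J = card (J \<inter> E1) + card (J \<inter> E2)" if "J \<subseteq> ?X" for J
    using card_eq_sum_of_traces[OF finite_subset[OF that fin] _ disj] that by auto
  have "matroid_rank ?indep ?X = card (I1 \<union> I2)"
  proof (rule matroid_rank_eqI[OF fin I(3)])
    show "?indep (I1 \<union> I2)" using I I1 I2 by (auto simp: direct_sum_indep_def)
    fix J assume J: "J \<subseteq> ?X" "?indep J"
    have "card (J \<inter> E1) \<le> card I1" "card (J \<inter> E2) \<le> card I2"
      using J I1(4)[of "J \<inter> E1"] I2(4)[of "J \<inter> E2"] by (auto simp: direct_sum_indep_def)
    then show "card J \<le> card (I1 \<union> I2)" using card[OF J(1)] card[OF I(3)] I by simp
  qed
  then show ?thesis
    using card[OF I(3)] I I1(3) I2(3) matroid_rank_Int_ground[OF direct_sum_matroid[OF assms]] by simp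
qed

text \<open>Both sides of the inequality are linear in the rank function, and taking traces commutes with unions.\<close>

lemma kinser_inequality_sum_of_traces:
  assumes "kinser_inequality n r (\<lambda>i. X i \<inter> C)" "kinser_inequality n s (\<lambda>i. X i \<inter> D)"
    and "\<And>A. u A = r (A \<inter> C) + s (A \<inter> D)"
  shows "kinser_inequality n u X"
  using assms(1,2) unfolding kinser_inequality_def assms(3)
  by (simp add: sum.distrib Int_Un_distrib2)

lemma kinser_class_infinity_direct_sum:
  assumes K: "(E1, indep1) \<in> kinser_class_infinity" "(E2, indep2) \<in> kinser_class_infinity"
    and disj: "E1 \<inter> E2 = {}"
  shows "(E1 \<union> E2, direct_sum_indep E1 indep1 E2 indep2) \<in> kinser_class_infinity"
proof -
  have M: "matroid E1 indep1" "matroid E2 indep2"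
    using assms by (auto simp: kinser_class_infinity_def kinser_class_def)
  have "kinser_inequality n (matroid_rank (direct_sum_indep E1 indep1 E2 indep2)) X"
    if "4 \<le> n" for n X
  proof (rule kinser_inequality_sum_of_traces)
    show "kinser_inequality n (matroid_rank indep1) (\<lambda>i. X i \<inter> E1)"
      "kinser_inequality n (matroid_rank indep2) (\<lambda>i. X i \<inter> E2)"
      using assms that by (auto simp: kinser_class_infinity_def kinser_class_def)
  qed (simp_all add: matroid_rank_direct_sum[OF M disj])
  then show ?thesis
    using direct_sum_matroid[OF M disj] by (auto simp: kinser_class_infinity_def kinser_class_def)
qed

section \<open>Seven vectors that detect characteristic two\<close>

context vectorspace
begin

lemma mem_span_insert:
  assumes S: "S \<subseteq> carrier V" and u: "u \<in> carrier V" and v: "v \<in> span (insert u S)"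
  obtains k w where "k \<in> carrier K" "w \<in> span S" "v = k \<odot>\<^bsub>V\<^esub> u \<oplus>\<^bsub>V\<^esub> w"
proof -
  have "v \<in> span (span {u} \<union> span S)"
    using span_span_Un[of "{u}" S] assms by simp
  then obtain x w where x: "x \<in> span {u}" and w: "w \<in> span S" and eq: "v = x \<oplus>\<^bsub>V\<^esub> w"
    using mem_span_Un_submodules[OF span_is_submodule[of "{u}"] span_is_submodule[OF S]] u by auto
  obtain k where "k \<in> carrier K" "x = k \<odot>\<^bsub>V\<^esub> u"
    using x u finite_span[of "{u}"] by (auto simp: lincomb_def)
  then show ?thesis using that w eq by blast
qed

lemma mem_span_pair:
  assumes "u \<in> carrier V" "w \<in> carrier V" "v \<in> span {u, w}"
  obtains k l where "k \<in> carrier K" "l \<in> carrier K" "v = k \<odot>\<^bsub>V\<^esub> u \<oplus>\<^bsub>V\<^esub> l \<odot>\<^bsub>V\<^esub> w"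
proof -
  obtain k z where kz: "k \<in> carrier K" "z \<in> span {w}" "v = k \<odot>\<^bsub>V\<^esub> u \<oplus>\<^bsub>V\<^esub> z"
    using mem_span_insert[of "{w}" u v] assms by auto
  obtain l where "l \<in> carrier K" "z = l \<odot>\<^bsub>V\<^esub> w"
    using kz(2) assms finite_span[of "{w}"] by (auto simp: lincomb_def)
  then show ?thesis using that kz by blast
qed

lemma smult_cancel_submodule:
  assumes N: "submodule K N V" and k: "k \<in> carrier K" "k \<noteq> \<zero>\<^bsub>K\<^esub>" and v: "v \<in> carrier V"
    and kv: "k \<odot>\<^bsub>V\<^esub> v \<in> N"
  shows "v \<in> N"
proof -
  have inv: "inv\<^bsub>K\<^esub> k \<in> carrier K" "inv\<^bsub>K\<^esub> k \<otimes>\<^bsub>K\<^esub> k = \<one>\<^bsub>K\<^esub>"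
    using k field_Units by (auto intro: Units_l_inv)
  have "v = inv\<^bsub>K\<^esub> k \<odot>\<^bsub>V\<^esub> (k \<odot>\<^bsub>V\<^esub> v)"
    using inv k v smult_assoc1[of "inv\<^bsub>K\<^esub> k" k v] by simp
  then show ?thesis using submodule.smult_closed[OF N inv(1) kv] by simp
qed

lemma submodule_add_cancel:
  assumes N: "submodule K N V" and "u \<in> N" "w \<in> carrier V" "u \<oplus>\<^bsub>V\<^esub> w \<in> N"
  shows "w \<in> N"
  using span_add[OF submodule.subset[OF N], of u w] assms span_submodule_eq[OF N] by auto

text \<open>If \<open>1 + 1 = 0\<close> then \<open>(x + y) + (x + z) = y + z\<close>. Conversely, comparing coefficients in
\<open>y + z = k (x + y) + l (x + z)\<close> gives \<open>k + l = 0\<close> and \<open>k = l = 1\<close>.\<close>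

lemma sum_of_three_mem_span_iff:
  assumes V: "x \<in> carrier V" "y \<in> carrier V" "z \<in> carrier V"
    and x: "x \<notin> span {y, z}" and y: "y \<notin> span {x, z}" and z: "z \<notin> span {x, y}"
  shows "y \<oplus>\<^bsub>V\<^esub> z \<in> span {x \<oplus>\<^bsub>V\<^esub> y, x \<oplus>\<^bsub>V\<^esub> z} \<longleftrightarrow> \<one>\<^bsub>K\<^esub> \<oplus>\<^bsub>K\<^esub> \<one>\<^bsub>K\<^esub> = \<zero>\<^bsub>K\<^esub>"
proof
  assume two: "\<one>\<^bsub>K\<^esub> \<oplus>\<^bsub>K\<^esub> \<one>\<^bsub>K\<^esub> = \<zero>\<^bsub>K\<^esub>"
  have "x \<oplus>\<^bsub>V\<^esub> x = \<zero>\<^bsub>V\<^esub>"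
    using smult_l_distr[of "\<one>\<^bsub>K\<^esub>" "\<one>\<^bsub>K\<^esub>" x] V two by simp
  moreover have "(x \<oplus>\<^bsub>V\<^esub> y) \<oplus>\<^bsub>V\<^esub> (x \<oplus>\<^bsub>V\<^esub> z) = (x \<oplus>\<^bsub>V\<^esub> x) \<oplus>\<^bsub>V\<^esub> (y \<oplus>\<^bsub>V\<^esub> z)"
    using V by (simp add: M.a_ac)
  ultimately have "(x \<oplus>\<^bsub>V\<^esub> y) \<oplus>\<^bsub>V\<^esub> (x \<oplus>\<^bsub>V\<^esub> z) = y \<oplus>\<^bsub>V\<^esub> z"
    using V by simp
  then show "y \<oplus>\<^bsub>V\<^esub> z \<in> span {x \<oplus>\<^bsub>V\<^esub> y, x \<oplus>\<^bsub>V\<^esub> z}"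
    using span_add1[of "{x \<oplus>\<^bsub>V\<^esub> y, x \<oplus>\<^bsub>V\<^esub> z}" "x \<oplus>\<^bsub>V\<^esub> y" "x \<oplus>\<^bsub>V\<^esub> z"] V
      in_own_span[of "{x \<oplus>\<^bsub>V\<^esub> y, x \<oplus>\<^bsub>V\<^esub> z}"] by auto
next
  assume "y \<oplus>\<^bsub>V\<^esub> z \<in> span {x \<oplus>\<^bsub>V\<^esub> y, x \<oplus>\<^bsub>V\<^esub> z}"
  then obtain k l where kl: "k \<in> carrier K" "l \<in> carrier K"
    and eq: "y \<oplus>\<^bsub>V\<^esub> z = k \<odot>\<^bsub>V\<^esub> (x \<oplus>\<^bsub>V\<^esub> y) \<oplus>\<^bsub>V\<^esub> l \<odot>\<^bsub>V\<^esub> (x \<oplus>\<^bsub>V\<^esub> z)"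
    using mem_span_pair[of "x \<oplus>\<^bsub>V\<^esub> y" "x \<oplus>\<^bsub>V\<^esub> z"] V by auto
  have sm: "a \<oplus>\<^bsub>V\<^esub> b \<in> span S" if "a \<in> span S" "b \<in> span S" "S \<subseteq> carrier V" for a b S
    using that span_add1 by auto
  have zeroI: "c = \<zero>\<^bsub>K\<^esub>" if "c \<in> carrier K" "v \<in> carrier V" "S \<subseteq> carrier V" "v \<notin> span S"
    "c \<odot>\<^bsub>V\<^esub> v \<in> span S" for c v S
    using smult_cancel_submodule[OF span_is_submodule] that by blast
  have own: "s \<in> span {s, t}" "t \<in> span {s, t}" if "s \<in> carrier V" "t \<in> carrier V" for s t
    using in_own_span[of "{s, t}"] that by auto
  have scal: "c \<odot>\<^bsub>V\<^esub> s \<in> span {s, t}" "c \<odot>\<^bsub>V\<^esub> t \<in> span {s, t}"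
    if "c \<in> carrier K" "s \<in> carrier V" "t \<in> carrier V" for c s t
    using own[OF that(2,3)] submodule.smult_closed[OF span_is_submodule[of "{s,t}"]] that by auto
  note cl = V kl
  have eq': "y \<oplus>\<^bsub>V\<^esub> z = (k \<oplus>\<^bsub>K\<^esub> l) \<odot>\<^bsub>V\<^esub> x \<oplus>\<^bsub>V\<^esub> (k \<odot>\<^bsub>V\<^esub> y \<oplus>\<^bsub>V\<^esub> l \<odot>\<^bsub>V\<^esub> z)"
    using cl by (simp add: eq smult_l_distr smult_r_distr M.a_ac)
  have "(k \<oplus>\<^bsub>K\<^esub> l) \<odot>\<^bsub>V\<^esub> x \<in> span {y, z}"
  proof (rule submodule_add_cancel[OF span_is_submodule])
    show "k \<odot>\<^bsub>V\<^esub> y \<oplus>\<^bsub>V\<^esub> l \<odot>\<^bsub>V\<^esub> z \<in> span {y, z}" using cl by (intro sm scal) auto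
    show "k \<odot>\<^bsub>V\<^esub> y \<oplus>\<^bsub>V\<^esub> l \<odot>\<^bsub>V\<^esub> z \<oplus>\<^bsub>V\<^esub> (k \<oplus>\<^bsub>K\<^esub> l) \<odot>\<^bsub>V\<^esub> x \<in> span {y, z}"
      using eq' cl sm[of y "{y,z}" z] own[of y z] by (simp add: M.a_comm)
  qed (use cl in auto)
  then have "k \<oplus>\<^bsub>K\<^esub> l = \<zero>\<^bsub>K\<^esub>" using zeroI[of _ x "{y, z}"] cl x by auto
  then have eq2: "y \<oplus>\<^bsub>V\<^esub> z = k \<odot>\<^bsub>V\<^esub> y \<oplus>\<^bsub>V\<^esub> l \<odot>\<^bsub>V\<^esub> z" using eq' cl by simp
  have one: "c = \<one>\<^bsub>K\<^esub>"
    if c: "c \<in> carrier K" "d \<in> carrier K" and v: "v \<in> carrier V" "w \<in> carrier V" "t \<in> carrier V"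
      and n: "v \<notin> span {t, w}" and e: "v \<oplus>\<^bsub>V\<^esub> w = c \<odot>\<^bsub>V\<^esub> v \<oplus>\<^bsub>V\<^esub> d \<odot>\<^bsub>V\<^esub> w" for c d v w t
  proof -
    have "(\<ominus>\<^bsub>K\<^esub> c \<oplus>\<^bsub>K\<^esub> \<one>\<^bsub>K\<^esub>) \<odot>\<^bsub>V\<^esub> v \<oplus>\<^bsub>V\<^esub> w = \<ominus>\<^bsub>K\<^esub> c \<odot>\<^bsub>V\<^esub> v \<oplus>\<^bsub>V\<^esub> (v \<oplus>\<^bsub>V\<^esub> w)"
      using c v by (simp add: smult_l_distr M.a_assoc)
    also have "\<dots> = (\<ominus>\<^bsub>K\<^esub> c \<oplus>\<^bsub>K\<^esub> c) \<odot>\<^bsub>V\<^esub> v \<oplus>\<^bsub>V\<^esub> d \<odot>\<^bsub>V\<^esub> w"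
      using c v by (simp only: e smult_l_distr M.a_assoc smult_closed R.a_inv_closed)
    also have "\<dots> = d \<odot>\<^bsub>V\<^esub> w" using c v by (simp add: R.l_neg)
    finally have "(\<ominus>\<^bsub>K\<^esub> c \<oplus>\<^bsub>K\<^esub> \<one>\<^bsub>K\<^esub>) \<odot>\<^bsub>V\<^esub> v \<oplus>\<^bsub>V\<^esub> w \<in> span {t, w}"
      using scal(2)[of d t w] c v by simp
    then have "w \<oplus>\<^bsub>V\<^esub> (\<ominus>\<^bsub>K\<^esub> c \<oplus>\<^bsub>K\<^esub> \<one>\<^bsub>K\<^esub>) \<odot>\<^bsub>V\<^esub> v \<in> span {t, w}"
      using c v by (simp add: M.a_comm)
    then have "(\<ominus>\<^bsub>K\<^esub> c \<oplus>\<^bsub>K\<^esub> \<one>\<^bsub>K\<^esub>) \<odot>\<^bsub>V\<^esub> v \<in> span {t, w}"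
      using c v submodule_add_cancel[OF span_is_submodule own(2), of t w] by simp
    then have "\<ominus>\<^bsub>K\<^esub> c \<oplus>\<^bsub>K\<^esub> \<one>\<^bsub>K\<^esub> = \<zero>\<^bsub>K\<^esub>"
      using c v n zeroI[of _ v "{t, w}"] by simp
    then show ?thesis using R.r_neg2[of c "\<one>\<^bsub>K\<^esub>"] c by simp
  qed
  have "k = \<one>\<^bsub>K\<^esub>" using one[of k l y z x] cl y eq2 by simp
  moreover have "l = \<one>\<^bsub>K\<^esub>"
    using one[of l k z y x] cl z eq2 by (simp add: M.a_comm)
  ultimately show "\<one>\<^bsub>K\<^esub> \<oplus>\<^bsub>K\<^esub> \<one>\<^bsub>K\<^esub> = \<zero>\<^bsub>K\<^esub>" using \<open>k \<oplus>\<^bsub>K\<^esub> l = \<zero>\<^bsub>K\<^esub>\<close> by simp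
qed

lemma zero_of_mem_three_planes:
  assumes V: "a \<in> carrier V" "b \<in> carrier V" "c \<in> carrier V"
    and a: "a \<notin> span {b, c}" and b: "b \<notin> span {a, c}"
    and w: "w \<in> span {a, b}" "w \<in> span {a, c}" "w \<in> span {b, c}"
  shows "w = \<zero>\<^bsub>V\<^esub>"
proof -
  obtain k l where kl: "k \<in> carrier K" "l \<in> carrier K" and eq: "w = k \<odot>\<^bsub>V\<^esub> a \<oplus>\<^bsub>V\<^esub> l \<odot>\<^bsub>V\<^esub> b"
    using mem_span_pair[OF V(1,2) w(1)] by metis
  have sub: "submodule K (span {a, c}) V" "submodule K (span {b, c}) V"
    using V by (simp_all add: span_is_submodule)
  have "a \<in> span {a, c}" using V by (simp add: span_mem)
  then have "k \<odot>\<^bsub>V\<^esub> a \<in> span {a, c}" using submodule.smult_closed[OF sub(1) kl(1)] by simp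
  then have "l \<odot>\<^bsub>V\<^esub> b \<in> span {a, c}"
    by (rule submodule_add_cancel[OF sub(1) _ _ w(2)[unfolded eq]]) (use kl V in simp)
  then have "l = \<zero>\<^bsub>K\<^esub>" using smult_cancel_submodule[OF sub(1) kl(2) _ V(2)] b by blast
  then have eq': "w = k \<odot>\<^bsub>V\<^esub> a" using eq kl V by simp
  then have "k = \<zero>\<^bsub>K\<^esub>" using smult_cancel_submodule[OF sub(2) kl(1) _ V(1)] a w(3) by blast
  then show ?thesis using eq' V by simp
qed

text \<open>The three lines through \<open>t\<close> give \<open>t = P + z = Q + y = S + x\<close>, where \<open>x\<close>, \<open>y\<close>, \<open>z\<close>, \<open>P\<close>, \<open>Q\<close>,
\<open>S\<close> are multiples of \<open>a\<close>, \<open>b\<close>, \<open>c\<close>, \<open>p\<close>, \<open>q\<close>, \<open>s\<close>. The vector \<open>t - (x + y + z)\<close> then lies in all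
three coordinate planes and vanishes, so \<open>P = x + y\<close>, \<open>Q = x + z\<close> and \<open>S = y + z\<close>. Since \<open>t\<close> lies in
no coordinate plane, \<open>x\<close>, \<open>y\<close>, \<open>z\<close> are independent and \<open>P\<close>, \<open>Q\<close>, \<open>S\<close> are nonzero multiples of
\<open>p\<close>, \<open>q\<close>, \<open>s\<close>, which reduces the claim to \<open>sum_of_three_mem_span_iff\<close>.\<close>

lemma seven_vectors_char_two_iff:
  assumes V: "a \<in> carrier V" "b \<in> carrier V" "c \<in> carrier V"
      "p \<in> carrier V" "q \<in> carrier V" "s \<in> carrier V" "t \<in> carrier V"
    and ab: "a \<notin> span {b, c}" "b \<notin> span {a, c}"
    and pqs: "p \<in> span {a, b}" "q \<in> span {a, c}" "s \<in> span {b, c}"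
    and t: "t \<in> span {p, c}" "t \<in> span {q, b}" "t \<in> span {s, a}"
    and nt: "t \<notin> span {a, b}" "t \<notin> span {a, c}" "t \<notin> span {b, c}"
  shows "s \<in> span {p, q} \<longleftrightarrow> \<one>\<^bsub>K\<^esub> \<oplus>\<^bsub>K\<^esub> \<one>\<^bsub>K\<^esub> = \<zero>\<^bsub>K\<^esub>"
proof -
  obtain kp kc where kp: "kp \<in> carrier K" "kc \<in> carrier K" "t = kp \<odot>\<^bsub>V\<^esub> p \<oplus>\<^bsub>V\<^esub> kc \<odot>\<^bsub>V\<^esub> c"
    using mem_span_pair[OF V(4,3) t(1)] by metis
  obtain kq kb where kq: "kq \<in> carrier K" "kb \<in> carrier K" "t = kq \<odot>\<^bsub>V\<^esub> q \<oplus>\<^bsub>V\<^esub> kb \<odot>\<^bsub>V\<^esub> b"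
    using mem_span_pair[OF V(5,2) t(2)] by metis
  obtain ks ka where ks: "ks \<in> carrier K" "ka \<in> carrier K" "t = ks \<odot>\<^bsub>V\<^esub> s \<oplus>\<^bsub>V\<^esub> ka \<odot>\<^bsub>V\<^esub> a"
    using mem_span_pair[OF V(6,1) t(3)] by metis
  define x y z where "x = ka \<odot>\<^bsub>V\<^esub> a" and "y = kb \<odot>\<^bsub>V\<^esub> b" and "z = kc \<odot>\<^bsub>V\<^esub> c"
  define P Q S where "P = kp \<odot>\<^bsub>V\<^esub> p" and "Q = kq \<odot>\<^bsub>V\<^esub> q" and "S = ks \<odot>\<^bsub>V\<^esub> s"
  have xyz: "x \<in> carrier V" "y \<in> carrier V" "z \<in> carrier V"
    and PQS: "P \<in> carrier V" "Q \<in> carrier V" "S \<in> carrier V"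
    using V kp kq ks by (simp_all add: x_def y_def z_def P_def Q_def S_def)
  have tP: "t = P \<oplus>\<^bsub>V\<^esub> z" and tQ: "t = Q \<oplus>\<^bsub>V\<^esub> y" and tS: "t = S \<oplus>\<^bsub>V\<^esub> x"
    using kp kq ks by (simp_all add: x_def y_def z_def P_def Q_def S_def)
  have sub: "submodule K (span {u, w}) V" if "u \<in> carrier V" "w \<in> carrier V" for u w
    using that by (simp add: span_is_submodule)
  have own: "u \<in> span {u, w}" "w \<in> span {u, w}" if "u \<in> carrier V" "w \<in> carrier V" for u w
    using that by (simp_all add: span_mem)
  note smem = submodule.smult_closed[OF sub]
  have x: "x \<in> span {a, b}" "x \<in> span {a, c}" and y: "y \<in> span {a, b}" "y \<in> span {b, c}"
    and z: "z \<in> span {a, c}" "z \<in> span {b, c}"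
    unfolding x_def y_def z_def using V kp kq ks own by (auto intro!: smem)
  have P: "P \<in> span {a, b}" and Q: "Q \<in> span {a, c}" and S: "S \<in> span {b, c}"
    unfolding P_def Q_def S_def using V kp kq ks pqs by (auto intro!: smem)
  define e where "e = t \<oplus>\<^bsub>V\<^esub> \<ominus>\<^bsub>V\<^esub> (x \<oplus>\<^bsub>V\<^esub> (y \<oplus>\<^bsub>V\<^esub> z))"
  have e: "e \<in> carrier V" using V xyz by (simp add: e_def)
  have te: "t = e \<oplus>\<^bsub>V\<^esub> (x \<oplus>\<^bsub>V\<^esub> (y \<oplus>\<^bsub>V\<^esub> z))"
    using V xyz by (simp add: e_def M.a_assoc M.l_neg)
  have Pe: "P = (x \<oplus>\<^bsub>V\<^esub> y) \<oplus>\<^bsub>V\<^esub> e"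
  proof -
    have "P \<oplus>\<^bsub>V\<^esub> z = ((x \<oplus>\<^bsub>V\<^esub> y) \<oplus>\<^bsub>V\<^esub> e) \<oplus>\<^bsub>V\<^esub> z"
      using te tP xyz e by (simp add: M.a_ac)
    then show ?thesis using xyz e PQS by simp
  qed
  have Qe: "Q = (x \<oplus>\<^bsub>V\<^esub> z) \<oplus>\<^bsub>V\<^esub> e"
  proof -
    have "Q \<oplus>\<^bsub>V\<^esub> y = ((x \<oplus>\<^bsub>V\<^esub> z) \<oplus>\<^bsub>V\<^esub> e) \<oplus>\<^bsub>V\<^esub> y"
      using te tQ xyz e by (simp add: M.a_ac)
    then show ?thesis using xyz e PQS by simp
  qed
  have Se: "S = (y \<oplus>\<^bsub>V\<^esub> z) \<oplus>\<^bsub>V\<^esub> e"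
  proof -
    have "S \<oplus>\<^bsub>V\<^esub> x = ((y \<oplus>\<^bsub>V\<^esub> z) \<oplus>\<^bsub>V\<^esub> e) \<oplus>\<^bsub>V\<^esub> x"
      using te tS xyz e by (simp add: M.a_ac)
    then show ?thesis using xyz e PQS by simp
  qed
  have cancel: "e \<in> span {u, w}"
    if "v \<in> span {u, w}" "v' \<in> span {u, w}" "(v \<oplus>\<^bsub>V\<^esub> v') \<oplus>\<^bsub>V\<^esub> e \<in> span {u, w}"
      "u \<in> carrier V" "w \<in> carrier V" for u w v v'
    using submodule_add_cancel[OF sub[OF that(4,5)] _ e that(3)]
      submodule.m_closed[OF sub[OF that(4,5)] that(1,2)] by blast
  \<comment> \<open>The differences \<open>P - (x + y)\<close>, \<open>Q - (x + z)\<close> and \<open>S - (y + z)\<close> all equal \<open>e\<close>.\<close>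
  have "e = \<zero>\<^bsub>V\<^esub>"
    using zero_of_mem_three_planes[OF V(1,2,3) ab] cancel[OF x(1) y(1)] cancel[OF x(2) z(1)]
      cancel[OF y(2) z(2)] P Q S Pe Qe Se V by metis
  then have PQS_eq: "P = x \<oplus>\<^bsub>V\<^esub> y" "Q = x \<oplus>\<^bsub>V\<^esub> z" "S = y \<oplus>\<^bsub>V\<^esub> z"
    using Pe Qe Se xyz by simp_all
  have span_le: "span {u, w} \<subseteq> span {u', w'}"
    if "u \<in> span {u', w'}" "w \<in> span {u', w'}" "u' \<in> carrier V" "w' \<in> carrier V" for u w u' w'
    using that by (intro span_is_subset span_is_submodule) auto
  have "x \<notin> span {y, z}"
    using span_le[OF y(2) z(2) V(2,3)] submodule.m_closed[OF sub[OF V(2,3)] S] nt(3) tS by blast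
  moreover have "y \<notin> span {x, z}"
    using span_le[OF x(2) z(1) V(1,3)] submodule.m_closed[OF sub[OF V(1,3)] Q] nt(2) tQ by blast
  moreover have "z \<notin> span {x, y}"
    using span_le[OF x(1) y(1) V(1,2)] submodule.m_closed[OF sub[OF V(1,2)] P] nt(1) tP by blast
  ultimately have main: "S \<in> span {P, Q} \<longleftrightarrow> \<one>\<^bsub>K\<^esub> \<oplus>\<^bsub>K\<^esub> \<one>\<^bsub>K\<^esub> = \<zero>\<^bsub>K\<^esub>"
    using sum_of_three_mem_span_iff[OF xyz] PQS_eq by simp
  have nz: "kp \<noteq> \<zero>\<^bsub>K\<^esub>" "kq \<noteq> \<zero>\<^bsub>K\<^esub>" "ks \<noteq> \<zero>\<^bsub>K\<^esub>"
  proof -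
    have "t \<noteq> x" "t \<noteq> y" "t \<noteq> z" using x y z nt by auto
    then show "kp \<noteq> \<zero>\<^bsub>K\<^esub>" "kq \<noteq> \<zero>\<^bsub>K\<^esub>" "ks \<noteq> \<zero>\<^bsub>K\<^esub>"
      using tP tQ tS xyz V unfolding P_def Q_def S_def by auto
  qed
  have "P \<in> span {p, q}" "Q \<in> span {p, q}"
    unfolding P_def Q_def using V kp kq own by (auto intro!: smem)
  then have 1: "span {P, Q} \<subseteq> span {p, q}" using span_le V by blast
  have "p \<in> span {P, Q}" "q \<in> span {P, Q}"
    using smult_cancel_submodule[OF sub[OF PQS(1,2)] kp(1) nz(1) V(4)]
      smult_cancel_submodule[OF sub[OF PQS(1,2)] kq(1) nz(2) V(5)] own[OF PQS(1,2)]
    unfolding P_def Q_def by blast+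
  then have "span {p, q} \<subseteq> span {P, Q}" using span_le PQS by blast
  with 1 have "span {p, q} = span {P, Q}" by blast
  moreover have "s \<in> span {P, Q} \<longleftrightarrow> S \<in> span {P, Q}"
    using smult_cancel_submodule[OF sub[OF PQS(1,2)] ks(1) nz(3) V(6)] smem[OF PQS(1,2) ks(1)]
    unfolding S_def by blast
  ultimately show ?thesis using main by simp
qed

lemma dim_span_insert_eq_iff:
  assumes S: "finite S" "S \<subseteq> carrier V" and x: "x \<in> carrier V"
  shows "vectorspace.dim K (vs (span (insert x S))) = vectorspace.dim K (vs (span S)) \<longleftrightarrow> x \<in> span S"
proof
  assume "x \<in> span S"
  then show "vectorspace.dim K (vs (span (insert x S))) = vectorspace.dim K (vs (span S))"
    using already_in_span[OF S(2)] by simp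
next
  assume eq: "vectorspace.dim K (vs (span (insert x S))) = vectorspace.dim K (vs (span S))"
  obtain B where B: "B \<subseteq> S" "lin_indpt B" "S \<subseteq> span B"
    using ex_indep_spanning_subset[OF S] by blast
  have BV: "B \<subseteq> carrier V" and fB: "finite B" using B(1) S finite_subset by auto
  have sB: "span B \<subseteq> span S" using span_is_monotone[OF B(1)] .
  show "x \<in> span S"
  proof (rule ccontr)
    assume "x \<notin> span S"
    then have nx: "x \<notin> span B" "x \<notin> B" using sB in_own_span[OF BV] by auto
    have xBV: "insert x B \<subseteq> carrier V" using BV x by simp
    have "lin_indpt (insert x B)"
      using lin_dep_iff_in_span[OF BV B(2) x nx(2)] nx(1) by simp
    moreover have "insert x S \<subseteq> span (insert x B)"
      using B(3) span_is_monotone[of B "insert x B"] in_own_span[OF xBV] by blast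
    ultimately have "vectorspace.dim K (vs (span (insert x S))) = card (insert x B)"
      using S x B(1) by (intro dim_span_eq_card) auto
    moreover have "vectorspace.dim K (vs (span S)) = card B"
      by (rule dim_span_eq_card[OF S B])
    ultimately show False using eq nx(2) fB by simp
  qed
qed

end

text \<open>Matroid closure, written with ranks: a representation turns it into membership in a linear span,
so collinearity conditions can be carried from one representation to another.\<close>

definition spanned :: "('a set \<Rightarrow> nat) \<Rightarrow> 'a set \<Rightarrow> 'a \<Rightarrow> bool" where
  "spanned r X x \<longleftrightarrow> r (insert x X) = r X"

lemma spanned_represented_iff:
  assumes rep: "represents K V \<phi> (E, indep)" and "finite E" "X \<subseteq> E" "x \<in> E"
  shows "spanned (matroid_rank indep) X x \<longleftrightarrow> \<phi> x \<in> LinearCombinations.module.span K V (\<phi> ` X)"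
proof -
  have rep': "vectorspace K V" "\<phi> \<in> E \<rightarrow> carrier V" "\<And>X. X \<subseteq> E \<Longrightarrow> matroid_rank indep X =
      vectorspace.dim K (V\<lparr>carrier := LinearCombinations.module.span K V (\<phi> ` X)\<rparr>)"
    using rep by (simp_all add: represents_def)
  interpret vectorspace K V by (rule rep'(1))
  have "finite (\<phi> ` X)" "\<phi> ` X \<subseteq> carrier V" "\<phi> x \<in> carrier V"
    using assms rep'(2) finite_subset by blast+
  then show ?thesis
    using dim_span_insert_eq_iff[of "\<phi> ` X" "\<phi> x"] rep'(3)[of X] rep'(3)[of "insert x X"] assms
    by (simp add: spanned_def)
qed

text \<open>The points \<open>e 0\<close>, \<open>e 1\<close>, \<open>e 2\<close> play the part of a basis, \<open>e 3\<close>, \<open>e 4\<close>, \<open>e 5\<close> lie on the sides of the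
triangle they form, and \<open>e 6\<close> is the common point of the three lines from these side points to the
opposite corners. These are six of the seven lines of the Fano plane; the Fano and the non-Fano
matroid differ in the seventh, \<open>{e 3, e 4, e 5}\<close>.\<close>

definition fano_frame :: "('a set \<Rightarrow> nat) \<Rightarrow> (nat \<Rightarrow> 'a) \<Rightarrow> bool" where
  "fano_frame r e \<longleftrightarrow>
     \<not> spanned r {e 1, e 2} (e 0) \<and> \<not> spanned r {e 0, e 2} (e 1) \<and>
     spanned r {e 0, e 1} (e 3) \<and> spanned r {e 0, e 2} (e 4) \<and> spanned r {e 1, e 2} (e 5) \<and>
     spanned r {e 3, e 2} (e 6) \<and> spanned r {e 4, e 1} (e 6) \<and> spanned r {e 5, e 0} (e 6) \<and>
     \<not> spanned r {e 0, e 1} (e 6) \<and> \<not> spanned r {e 0, e 2} (e 6) \<and> \<not> spanned r {e 1, e 2} (e 6)"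

lemma fano_frame_char_two_iff:
  assumes rep: "represents K V \<phi> (E, indep)" and "finite E" and e: "\<And>i. i < 7 \<Longrightarrow> e i \<in> E"
    and frame: "fano_frame (matroid_rank indep) e"
  shows "spanned (matroid_rank indep) {e 3, e 4} (e 5) \<longleftrightarrow> \<one>\<^bsub>K\<^esub> \<oplus>\<^bsub>K\<^esub> \<one>\<^bsub>K\<^esub> = \<zero>\<^bsub>K\<^esub>"
proof -
  have rep': "vectorspace K V" "\<phi> \<in> E \<rightarrow> carrier V"
    using rep by (simp_all add: represents_def)
  interpret vectorspace K V by (rule rep'(1))
  have sp: "spanned (matroid_rank indep) {e i, e j} (e k) \<longleftrightarrow> \<phi> (e k) \<in> span {\<phi> (e i), \<phi> (e j)}"
    if "i < 7" "j < 7" "k < 7" for i j k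
    using spanned_represented_iff[OF rep \<open>finite E\<close>, of "{e i, e j}" "e k"] e that by simp
  have V: "\<phi> (e i) \<in> carrier V" if "i < 7" for i using e[OF that] rep'(2) by blast
  show ?thesis
    using frame seven_vectors_char_two_iff[of "\<phi> (e 0)" "\<phi> (e 1)" "\<phi> (e 2)" "\<phi> (e 3)" "\<phi> (e 4)" "\<phi> (e 5)" "\<phi> (e 6)"]
    unfolding fano_frame_def by (simp add: sp V)
qed

lemma spanned_shift:
  assumes "\<And>A. A \<subseteq> B \<Longrightarrow> r A = r' A + k" "X \<subseteq> B" "x \<in> B"
  shows "spanned r X x \<longleftrightarrow> spanned r' X x"
  using assms by (simp add: spanned_def)

text \<open>In a direct sum, the rank of a subset of one summand exceeds its rank in that summand by the
constant rank of the empty set in the other. Only differences of ranks enter \<open>spanned\<close>.\<close>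

lemma fano_frame_shift:
  assumes "\<And>A. A \<subseteq> B \<Longrightarrow> r A = r' A + k" "\<And>i. i < 7 \<Longrightarrow> e i \<in> B"
  shows "fano_frame r e \<longleftrightarrow> fano_frame r' e"
    "spanned r {e 3, e 4} (e 5) \<longleftrightarrow> spanned r' {e 3, e 4} (e 5)"
proof -
  have "spanned r {e i, e j} (e k) \<longleftrightarrow> spanned r' {e i, e j} (e k)"
    if "i < 7" "j < 7" "k < 7" for i j k
    using assms that by (intro spanned_shift) auto
  then show "fano_frame r e \<longleftrightarrow> fano_frame r' e"
    "spanned r {e 3, e 4} (e 5) \<longleftrightarrow> spanned r' {e 3, e 4} (e 5)"
    by (simp_all add: fano_frame_def)
qed

text \<open>The nonzero vectors with all coordinates 0 or 1, listed by their supports in the order that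
\<open>fano_frame\<close> expects.\<close>

definition fano_vector :: "nat \<Rightarrow> 'f::field vec" where
  "fano_vector i = vec 3 (\<lambda>j. if j \<in> [{0}, {1}, {2}, {0, 1}, {0, 2}, {1, 2}, {0, 1, 2}] ! i then 1 else 0)"

lemma (in vec_space) not_in_span_of_coordinate:
  assumes "S \<subseteq> carrier_vec n" "j < n" "\<And>u. u \<in> S \<Longrightarrow> u $ j = 0" "v $ j \<noteq> 0"
  shows "v \<notin> span S"
proof -
  have "submodule class_ring {v \<in> carrier_vec n. v $ j = 0} V"
    using assms(2) module_axioms by (auto simp: submodule_def)
  then have "span S \<subseteq> {v \<in> carrier_vec n. v $ j = 0}"
    using assms by (intro span_is_subset) auto
  then show ?thesis using assms(4) by auto
qed

text \<open>The offset places copies of the configuration on disjoint sets of natural numbers. Memberships hold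
because each of the vectors in question is a sum of two others, and non-memberships because some
coordinate vanishes on the spanning pair but not on the vector.\<close>

lemma fano_frame_exists:
  fixes off :: nat
  defines "K \<equiv> class_ring :: 'f::field ring" and "V \<equiv> module_vec TYPE('f) 3"
    and "\<phi> \<equiv> \<lambda>i. fano_vector (i - off)"
  shows "represents K V \<phi> ({off..<off + 7}, vector_indep K V \<phi> {off..<off + 7})"
    and "matroid {off..<off + 7} (vector_indep K V \<phi> {off..<off + 7})"
    and "fano_frame (matroid_rank (vector_indep K V \<phi> {off..<off + 7})) (\<lambda>i. off + i)"
proof -
  interpret vec_space "TYPE('f)" 3 .
  have \<phi>: "\<phi> \<in> {off..<off + 7} \<rightarrow> carrier V"
    by (auto simp: \<phi>_def V_def fano_vector_def module_vec_def)
  have vsp: "vectorspace K V" unfolding K_def V_def by (rule vec_vs)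
  show rep: "represents K V \<phi> ({off..<off + 7}, vector_indep K V \<phi> {off..<off + 7})"
    by (rule vectorspace.vector_matroid_represented[OF vsp _ \<phi>]) simp
  show "matroid {off..<off + 7} (vector_indep K V \<phi> {off..<off + 7})"
    by (rule vectorspace.vector_matroid[OF vsp _ \<phi>]) simp
  let ?v = "fano_vector :: nat \<Rightarrow> 'f vec"
  have C: "?v i \<in> carrier_vec 3" for i by (simp add: fano_vector_def)
  have sp: "spanned (matroid_rank (vector_indep K V \<phi> {off..<off + 7})) {off + i, off + j} (off + k)
      \<longleftrightarrow> ?v k \<in> span {?v i, ?v j}" if "i < 7" "j < 7" "k < 7" for i j k
    using spanned_represented_iff[OF rep, of "{off + i, off + j}" "off + k"] that
    by (simp add: \<phi>_def K_def V_def)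
  have nin: "?v k \<notin> span {?v i, ?v j}"
    if "l < 3" "?v i $ l = 0" "?v j $ l = 0" "?v k $ l \<noteq> 0" for i j k l
    using that C by (intro not_in_span_of_coordinate[of _ l]) auto
  have "?v i + ?v j \<in> span {?v i, ?v j}" for i j
    using span_add1[of "{?v i, ?v j}" "?v i" "?v j"] in_own_span[of "{?v i, ?v j}"] C by simp
  then have inn: "?v k \<in> span {?v i, ?v j}" if "?v k = ?v i + ?v j" for i j k
    using that by simp
  have sums: "?v 3 = ?v 0 + ?v 1" "?v 4 = ?v 0 + ?v 2" "?v 5 = ?v 1 + ?v 2"
    "?v 6 = ?v 3 + ?v 2" "?v 6 = ?v 4 + ?v 1" "?v 6 = ?v 5 + ?v 0"
    by (rule eq_vecI; force simp: fano_vector_def less_Suc_eq numeral_3_eq_3)+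
  have "fano_frame (matroid_rank (vector_indep K V \<phi> {off..<off + 7})) (\<lambda>i. off + i)
    \<longleftrightarrow> ?v 0 \<notin> span {?v 1, ?v 2} \<and> ?v 1 \<notin> span {?v 0, ?v 2} \<and>
     ?v 3 \<in> span {?v 0, ?v 1} \<and> ?v 4 \<in> span {?v 0, ?v 2} \<and> ?v 5 \<in> span {?v 1, ?v 2} \<and>
     ?v 6 \<in> span {?v 3, ?v 2} \<and> ?v 6 \<in> span {?v 4, ?v 1} \<and> ?v 6 \<in> span {?v 5, ?v 0} \<and>
     ?v 6 \<notin> span {?v 0, ?v 1} \<and> ?v 6 \<notin> span {?v 0, ?v 2} \<and> ?v 6 \<notin> span {?v 1, ?v 2}"
    unfolding fano_frame_def by (simp only: sp)
  moreover have "?v 0 \<notin> span {?v 1, ?v 2}" "?v 6 \<notin> span {?v 1, ?v 2}"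
    by (rule nin[of 0]; simp add: fano_vector_def)+
  moreover have "?v 1 \<notin> span {?v 0, ?v 2}" "?v 6 \<notin> span {?v 0, ?v 2}"
    by (rule nin[of 1]; simp add: fano_vector_def)+
  moreover have "?v 6 \<notin> span {?v 0, ?v 1}"
    by (rule nin[of 2]; simp add: fano_vector_def)
  ultimately show "fano_frame (matroid_rank (vector_indep K V \<phi> {off..<off + 7})) (\<lambda>i. off + i)"
    using sums[THEN inn] by blast
qed

section \<open>The Fano and non-Fano matroids together\<close>

text \<open>The witness is the direct sum of the Fano matroid, realized over the field with two elements, and
the non-Fano matroid, realized over the rationals.\<close>

lemma kinser_not_representable:
  obtains M :: "nat matroid" where "M \<in> kinser_class_infinity" "M \<notin> representable_matroids"
proof -
  \<comment> \<open>The zero offset stays explicit, as in \<open>0 + 7\<close> and \<open>i - 0\<close>, so that both instances of \<open>fano_frame_exists\<close> fold.\<close>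
  let ?E1 = "{0..<0 + 7} :: nat set" and ?E2 = "{7..<7 + 7} :: nat set"
  define I1 where "I1 = vector_indep (class_ring :: bit ring) (module_vec TYPE(bit) 3)
    (\<lambda>i. fano_vector (i - 0)) ?E1"
  define I2 where "I2 = vector_indep (class_ring :: rat ring) (module_vec TYPE(rat) 3)
    (\<lambda>i. fano_vector (i - 7)) ?E2"
  note F1 = fano_frame_exists[where 'f = bit and off = 0, folded I1_def]
  note F2 = fano_frame_exists[where 'f = rat and off = 7, folded I2_def]
  let ?I = "direct_sum_indep ?E1 I1 ?E2 I2"
  have disj: "?E1 \<inter> ?E2 = {}" by auto
  have fano: "spanned (matroid_rank I1) {0 + 3, 0 + 4} (0 + 5)"
    using fano_frame_char_two_iff[OF F1(1) _ _ F1(3)] by simp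
  have nonfano: "\<not> spanned (matroid_rank I2) {7 + 3, 7 + 4} (7 + 5)"
    using fano_frame_char_two_iff[OF F2(1) _ _ F2(3)] by simp
  have K: "(?E1 \<union> ?E2, ?I) \<in> kinser_class_infinity"
    by (intro kinser_class_infinity_direct_sum represents_imp_kinser[OF F1(2,1)]
        represents_imp_kinser[OF F2(2,1)] disj)
  note rank = matroid_rank_direct_sum[OF F1(2) F2(2) disj]
  have rank1: "matroid_rank ?I A = matroid_rank I1 A + matroid_rank I2 {}" if "A \<subseteq> ?E1" for A
  proof -
    have "A \<inter> ?E1 = A" "A \<inter> ?E2 = {}" using that disj by auto
    then show ?thesis by (simp only: rank)
  qed
  have rank2: "matroid_rank ?I A = matroid_rank I2 A + matroid_rank I1 {}" if "A \<subseteq> ?E2" for A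
  proof -
    have "A \<inter> ?E2 = A" "A \<inter> ?E1 = {}" using that disj by auto
    then show ?thesis by (simp only: rank add.commute)
  qed
  have shift1: "fano_frame (matroid_rank ?I) (\<lambda>i. 0 + i)"
    "spanned (matroid_rank ?I) {0 + 3, 0 + 4} (0 + 5)"
    using fano_frame_shift[OF rank1, where e = "\<lambda>i. 0 + i"] F1(3) fano by auto
  have shift2: "fano_frame (matroid_rank ?I) (\<lambda>i. 7 + i)"
    "\<not> spanned (matroid_rank ?I) {7 + 3, 7 + 4} (7 + 5)"
    using fano_frame_shift[OF rank2, where e = "\<lambda>i. 7 + i"] F2(3) nonfano by auto
  have "(?E1 \<union> ?E2, ?I) \<notin> representable_matroids"
  proof
    assume "(?E1 \<union> ?E2, ?I) \<in> representable_matroids"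
    then obtain K :: "nat ring" and V :: "(nat, nat) module" and \<phi>
      where rep: "represents K V \<phi> (?E1 \<union> ?E2, ?I)" unfolding representable_matroids_def by blast
    show False
      using fano_frame_char_two_iff[OF rep _ _ shift1(1)] shift1(2)
        fano_frame_char_two_iff[OF rep _ _ shift2(1)] shift2(2) by simp
  qed
  with K show ?thesis by (rule that)
qed

lemma representable_subset_kinser: "representable_matroids \<subseteq> kinser_class_infinity"
  unfolding representable_matroids_def using represents_imp_kinser by blast

theorem lemma4p1:
  "(representable_matroids :: 'a matroid set) \<subseteq> kinser_class_infinity \<and>
   (representable_matroids :: nat matroid set) \<subset> kinser_class_infinity"
  using representable_subset_kinser kinser_not_representable by (metis psubsetI)

end
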